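(* Let $n\ge3$. For $I\subseteq\{1,\ldots,n\}$ let $\xi_I=\sum_{i\in I}H_i$, and for $i=1,2$ let $\varepsilon_I^i=1$ if $|I\cap\{n-1,n\}|=i$ and $\varepsilon_I^i=0$ otherwise. The symmetric canonical elements of $SO(2n)$ are precisely the elements of the form $\xi_I+\varepsilon_I^1H_s$ and $\xi_I+\varepsilon_I^1H_s+2\varepsilon_I^2H_s$, where $I\subseteq\{1,\ldots,n\}$ and $s\in\{n-1,n\}\cap I$ (terms with zero coefficient being absent).
   Context: General setting. Let $G$ be a compact connected Lie group with Lie algebra $\mathfrak g$, $\mathfrak t\subset\mathfrak g$ a maximal torus (maximal abelian subalgebra), $\alpha_1,\ldots,\alpha_n\in\sqrt{-1}\,\mathfrak t^*$ the positive simple roots for a chosen set of positive roots $\Delta^+$, and $H_1,\ldots,H_n\in\mathfrak t$ the dual basis: $\alpha_i(H_j)=\sqrt{-1}\,\delta_{ij}$. Put $\mathfrak I(G)=\{\xi\in\mathfrak t:\exp_G(2\pi\xi)=e\}$, $\mathfrak I'(G)=\{\xi\in\mathfrak I(G): \alpha(\xi)/\sqrt{-1}\ge 0 \text{ for all }\alpha\in\Delta^+\}$ and $\mathfrak I^2(G)=\{\xi\in\mathfrak t:\exp_G(\pi\xi)=e\}$. For $\xi\in\mathfrak I'(G)$ let $\mathfrak g^\xi_j$ ($j\in\mathbb Z$) be the $\sqrt{-1}\,j$-eigenspace of $\mathrm{ad}\,\xi$ on $\mathfrak g^{\mathbb C}$ and $\mathfrak p_i^\xi=\bigoplus_{j\le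 i}\mathfrak g_j^\xi$. Define $\xi\preceq\xi'$ iff $\mathfrak p^\xi_i\subseteq\mathfrak p^{\xi'}_i$ for all $i\ge 0$ (writing $\xi=\sum n_iH_i$, $\xi'=\sum n_i'H_i$, this is equivalent to $n_i'\le n_i$ for all $i$). Define a second partial order on $\mathfrak I'(G)$ by: $\xi\preceq_{\mathcal I}\xi'$ iff $\xi\preceq\xi'$ and $\xi-\xi'\in\mathfrak I^2(G)$. A symmetric canonical element of $G$ is a maximal element of $(\mathfrak I'(G),\preceq_{\mathcal I})$. The case $(D_n)$, $G=SO(2n)$. With respect to a basis $e_1,\ldots,e_{2n}$ of $\mathbb C^{2n}=(\mathbb R^{2n})^{\mathbb C}$ with $e_{n+i}=\overline{e_i}$, $Q(e_i,e_{n+i})=1$ and all other pairings zero ($Q$ the complex-bilinear extension of the standard inner product of $\mathbb R^{2n}$), $E_i$ is the diagonal matrix with $E_ie_i=\sqrt{-1}e_i$, $E_ie_{n+i}=-\sqrt{-1}e_{n+i}$ and zero on the other basis vectors. $\mathfrak t=\{\sum a_iE_i:a_i\in\mathbb R\}$, $L_i(E_j)=\sqrt{-1}\,\delta_{ij}$. The positive roots are $\Delta^+=\{L_i\pm L_j\}_{i<j}$, with simple roots $\alpha_i=L_i-L_{i+1}$ for $1\le i\le n-1$ and $\alpha_n=L_{n-1}+L_n$, so that $H_i=E_1+\ldots+E_i$ for $1\le i\le n-2$, $H_{n-1}=\frac12(E_1+\ldots+E_{n-1}-E_n)$ and $H_n=\frac12(E_1+\ldots+E_{n-1}+E_n)$.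 *)

theory Defs
  imports "HOL-Analysis.Analysis" "HOL-Library.Nonpos_Ints"
begin

text \<open>
  Compact Lie groups are treated as groups \<open>G\<close> of complex matrices acting on
  \<open>complex ^ 'm\<close>, which loses no generality since every compact Lie group is linear.
  The library function \<open>exp\<close> does not apply to matrices (the type-class product on
  \<open>'a ^ 'm ^ 'm\<close> is entrywise), so the exponential series is written with \<open>**\<close>.
\<close>

definition mat_exp :: "complex^'m^'m \<Rightarrow> complex^'m^'m" where
  "mat_exp A = (\<Sum>k. (1 / fact k) *\<^sub>R ((((**) A) ^^ k) (mat 1)))"

definition cscale :: "complex \<Rightarrow> complex^'m^'m \<Rightarrow> complex^'m^'m" where
  "cscale c A = (\<chi> i j. c * A $ i $ j)"

definition lie_algebra :: "(complex^'m^'m) set \<Rightarrow> (complex^'m^'m) set" where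
  "lie_algebra G = {X. \<forall>t::real. mat_exp (t *\<^sub>R X) \<in> G}"

text \<open>
  For compact \<open>G\<close> the Lie algebra meets \<open>\<i>\<close> times itself only in \<open>0\<close>, so the complexification
  can be formed inside the complex matrices.
\<close>

definition complexification :: "(complex^'m^'m) set \<Rightarrow> (complex^'m^'m) set" where
  "complexification g = {X + cscale \<i> Y | X Y. X \<in> g \<and> Y \<in> g}"

definition ad :: "complex^'m^'m \<Rightarrow> complex^'m^'m \<Rightarrow> complex^'m^'m" where
  "ad \<xi> X = \<xi> ** X - X ** \<xi>"

definition ad_eigenspace ::
    "(complex^'m^'m) set \<Rightarrow> complex^'m^'m \<Rightarrow> int \<Rightarrow> (complex^'m^'m) set" where
  "ad_eigenspace G \<xi> j =
     {X \<in> complexification (lie_algebra G). ad \<xi> X = cscale (\<i> * of_int j) X}"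

text \<open>
  Eigenspaces for distinct eigenvalues are independent complex subspaces, so the span of their
  union (real or complex) is their direct sum.
\<close>

definition parabolic :: "(complex^'m^'m) set \<Rightarrow> complex^'m^'m \<Rightarrow> int \<Rightarrow> (complex^'m^'m) set" where
  "parabolic G \<xi> i = span (\<Union>j\<in>{..i}. ad_eigenspace G \<xi> j)"

text \<open>
  In the following, \<open>\<tt>\<close> is a maximal torus of the Lie algebra of \<open>G\<close> and \<open>\<Delta>\<close> a set of positive
  roots, viewed as functionals on \<open>\<tt>\<close> with purely imaginary values.
\<close>

definition integer_lattice :: "(complex^'m^'m) set \<Rightarrow> (complex^'m^'m) set" where
  "integer_lattice \<tt> = {\<xi> \<in> \<tt>. mat_exp ((2 * pi) *\<^sub>R \<xi>) = mat 1}"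

definition canonical_lattice ::
    "(complex^'m^'m) set \<Rightarrow> (complex^'m^'m \<Rightarrow> complex) set \<Rightarrow> (complex^'m^'m) set" where
  "canonical_lattice \<tt> \<Delta> = {\<xi> \<in> integer_lattice \<tt>. \<forall>\<alpha>\<in>\<Delta>. \<alpha> \<xi> / \<i> \<in> \<real>\<^sub>\<ge>\<^sub>0}"

definition half_lattice :: "(complex^'m^'m) set \<Rightarrow> (complex^'m^'m) set" where
  "half_lattice \<tt> = {\<xi> \<in> \<tt>. mat_exp (pi *\<^sub>R \<xi>) = mat 1}"

definition canon_le :: "(complex^'m^'m) set \<Rightarrow> complex^'m^'m \<Rightarrow> complex^'m^'m \<Rightarrow> bool" where
  "canon_le G \<xi> \<xi>' \<longleftrightarrow> (\<forall>i\<ge>0. parabolic G \<xi> i \<subseteq> parabolic G \<xi>' i)"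

definition sym_canon_le ::
    "(complex^'m^'m) set \<Rightarrow> (complex^'m^'m) set \<Rightarrow> complex^'m^'m \<Rightarrow> complex^'m^'m \<Rightarrow> bool" where
  "sym_canon_le G \<tt> \<xi> \<xi>' \<longleftrightarrow> canon_le G \<xi> \<xi>' \<and> \<xi> - \<xi>' \<in> half_lattice \<tt>"

definition symmetric_canonical_elements ::
    "(complex^'m^'m) set \<Rightarrow> (complex^'m^'m) set \<Rightarrow> (complex^'m^'m \<Rightarrow> complex) set
      \<Rightarrow> (complex^'m^'m) set" where
  "symmetric_canonical_elements G \<tt> \<Delta> =
     {\<xi> \<in> canonical_lattice \<tt> \<Delta>.
        \<forall>\<xi>' \<in> canonical_lattice \<tt> \<Delta>. sym_canon_le G \<tt> \<xi> \<xi>' \<longrightarrow> \<xi>' = \<xi>}"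

text \<open>The basis of \<open>\<tt>\<close> dual to functionals \<open>\<alpha> 1, \<dots>, \<alpha> n\<close>, up to the factor \<open>\<i>\<close>.\<close>

definition dual_basis ::
    "(complex^'m^'m) set \<Rightarrow> nat \<Rightarrow> (nat \<Rightarrow> complex^'m^'m \<Rightarrow> complex) \<Rightarrow> nat \<Rightarrow> complex^'m^'m" where
  "dual_basis \<tt> n \<alpha> j =
     (THE X. X \<in> \<tt> \<and> (\<forall>i\<in>{1..n}. \<alpha> i X = (if i = j then \<i> else 0)))"


text \<open>The real matrices in \<open>SO(m)\<close>, regarded as complex ones.\<close>

definition SO :: "(complex^'m^'m) set" where
  "SO = {\<chi> i j. complex_of_real (A $ i $ j) | A :: real^'m^'m. rotation_matrix A}"

definition bilinQ :: "complex^'m \<Rightarrow> complex^'m \<Rightarrow> complex" where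
  "bilinQ v w = (\<Sum>k\<in>UNIV. v $ k * w $ k)"

text \<open>Indices of the basis run over \<open>{1..2 * n}\<close>; values of \<open>e\<close> elsewhere are irrelevant.\<close>

definition isotropic_basis :: "nat \<Rightarrow> (nat \<Rightarrow> complex^'m) \<Rightarrow> bool" where
  "isotropic_basis n e \<longleftrightarrow>
     inj_on e {1..2 * n} \<and> vec.independent (e ` {1..2 * n}) \<and> vec.span (e ` {1..2 * n}) = UNIV \<and>
     (\<forall>i\<in>{1..n}. e (n + i) = (\<chi> k. cnj (e i $ k))) \<and>
     (\<forall>k\<in>{1..2 * n}. \<forall>l\<in>{1..2 * n}.
        bilinQ (e k) (e l) = (if l = n + k \<or> k = n + l then 1 else 0))"

text \<open>
  The matrix, in standard coordinates, of the operator which is diagonal with respect to \<open>e\<close>.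
\<close>

definition diag_in_basis :: "nat \<Rightarrow> (nat \<Rightarrow> complex^'m) \<Rightarrow> (nat \<Rightarrow> complex) \<Rightarrow> complex^'m^'m" where
  "diag_in_basis N e d = (THE A. \<forall>k\<in>{1..N}. A *v e k = d k *s e k)"

definition D_E :: "nat \<Rightarrow> (nat \<Rightarrow> complex^'m) \<Rightarrow> nat \<Rightarrow> complex^'m^'m" where
  "D_E n e i =
     diag_in_basis (2 * n) e (\<lambda>k. if k = i then \<i> else if k = n + i then - \<i> else 0)"

definition D_torus :: "nat \<Rightarrow> (nat \<Rightarrow> complex^'m) \<Rightarrow> (complex^'m^'m) set" where
  "D_torus n e = {\<Sum>i=1..n. a i *\<^sub>R D_E n e i | a :: nat \<Rightarrow> real. True}"

text \<open>
  The real-linear functional on the torus with \<open>L\<^sub>i(E\<^sub>j) = \<i> \<delta>\<^sub>i\<^sub>j\<close>; only its values on the torus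
  are used.
\<close>

definition D_L :: "nat \<Rightarrow> (nat \<Rightarrow> complex^'m) \<Rightarrow> nat \<Rightarrow> complex^'m^'m \<Rightarrow> complex" where
  "D_L n e i = construct (D_E n e ` {1..n}) (\<lambda>X. if X = D_E n e i then \<i> else 0)"

definition D_pos_roots :: "nat \<Rightarrow> (nat \<Rightarrow> complex^'m) \<Rightarrow> (complex^'m^'m \<Rightarrow> complex) set" where
  "D_pos_roots n e =
     {(\<lambda>\<xi>. D_L n e i \<xi> + D_L n e j \<xi>) | i j. 1 \<le> i \<and> i < j \<and> j \<le> n} \<union>
     {(\<lambda>\<xi>. D_L n e i \<xi> - D_L n e j \<xi>) | i j. 1 \<le> i \<and> i < j \<and> j \<le> n}"

definition D_simple_root :: "nat \<Rightarrow> (nat \<Rightarrow> complex^'m) \<Rightarrow> nat \<Rightarrow> complex^'m^'m \<Rightarrow> complex" where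
  "D_simple_root n e i \<xi> =
     (if i < n then D_L n e i \<xi> - D_L n e (i + 1) \<xi> else D_L n e (n - 1) \<xi> + D_L n e n \<xi>)"

definition D_H :: "nat \<Rightarrow> (nat \<Rightarrow> complex^'m) \<Rightarrow> nat \<Rightarrow> complex^'m^'m" where
  "D_H n e = dual_basis (D_torus n e) n (D_simple_root n e)"

definition D_xi :: "nat \<Rightarrow> (nat \<Rightarrow> complex^'m) \<Rightarrow> nat set \<Rightarrow> complex^'m^'m" where
  "D_xi n e I = (\<Sum>i\<in>I. D_H n e i)"

definition eps :: "nat \<Rightarrow> nat \<Rightarrow> nat set \<Rightarrow> real" where
  "eps n i I = (if card (I \<inter> {n - 1, n}) = i then 1 else 0)"

end

theory Submission
  imports Defs
begin

text \<open>
  Everything happens in the coordinates of the basis \<open>e\<close>. An element \<open>\<Sum> c\<^sub>i E\<^sub>i\<close> of the torus is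
  diagonal in this basis with eigenvalues \<open>\<plusminus>\<i> c\<^sub>i\<close>, so it exponentiates to the identity at
  time \<open>2 \<pi>\<close> iff all \<open>c\<^sub>i\<close> are integers, and at time \<open>\<pi>\<close> iff all \<open>c\<^sub>i\<close> are even integers. The
  complexified Lie algebra of \<open>SO\<close> is the space of complex skew matrices
  (\<open>complexification_lie_algebra_SO\<close>). It is spanned by the root vectors
  \<open>e\<^sub>a e\<^sub>b\<^sup>T - e\<^sub>b e\<^sub>a\<^sup>T\<close>, on which \<open>ad\<close> of a torus element acts by the sum of two weights. Comparing
  the spans of eigenspaces root vector by root vector turns the order on dominant integral elements
  into dominance of their difference (\<open>canon_le_torus_elt_iff\<close>).

  The dual basis \<open>H\<^sub>1, \<dots>, H\<^sub>n\<close> reduces the rest to arithmetic. Write an element as \<open>\<Sum> m\<^sub>i H\<^sub>i\<close>,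
  with marks \<open>m\<^sub>i = c\<^sub>i - c\<^bsub>i+1\<^esub>\<close> for \<open>i < n\<close> and \<open>m\<^sub>n = c\<^bsub>n-1\<^esub> + c\<^sub>n\<close>. It lies in the
  canonical lattice iff the marks are natural numbers with \<open>m\<^bsub>n-1\<^esub> + m\<^sub>n\<close> even, the order reverses
  the componentwise order of marks, and two elements differ by the half lattice iff all the
  differences of their marks are even and the last two differences add up to a multiple of 4
  (\<open>canonical_lattice_eq\<close>, \<open>sym_canon_le_mark_elt_iff\<close>).

  Hence an element is maximal iff no mark can be lowered by an admissible amount: by 2 in a place
  before \<open>n - 1\<close>, by 4 in one of the last two places, or by 2 in both of them. This leaves the
  marks 0 and 1 in the first places and, together with the parity condition, the pairs \<open>(0,0)\<close>,
  \<open>(2,0)\<close>, \<open>(0,2)\<close>, \<open>(1,1)\<close>, \<open>(3,1)\<close>, \<open>(1,3)\<close> in the last two. If \<open>I\<close> is the support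
  of the marks, then the pairs with one nonzero entry are \<open>\<xi>\<^sub>I + H\<^sub>s\<close>, the pairs
  \<open>(0,0)\<close> and \<open>(1,1)\<close> are \<open>\<xi>\<^sub>I\<close>, and \<open>(3,1)\<close>, \<open>(1,3)\<close> are \<open>\<xi>\<^sub>I + 2 H\<^sub>s\<close>, which is the claim.
\<close>

section \<open>The matrix exponential\<close>

abbreviation mat_pow :: "complex^'m^'m \<Rightarrow> nat \<Rightarrow> complex^'m^'m" where
  "mat_pow A k \<equiv> (((**) A) ^^ k) (mat 1)"

lemma scaleR_matrix_mult_left: "(r *\<^sub>R A) ** B = r *\<^sub>R (A ** (B :: complex^'m^'m))"
  by (simp add: vec_eq_iff matrix_matrix_mult_def scaleR_right.sum)

lemma scaleR_matrix_mult_right: "A ** (r *\<^sub>R B) = r *\<^sub>R (A ** (B :: complex^'m^'m))"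
  by (simp add: vec_eq_iff matrix_matrix_mult_def scaleR_right.sum)

lemma mat_pow_scaleR: "mat_pow (t *\<^sub>R A) k = t ^ k *\<^sub>R mat_pow A k"
  by (induction k) (simp_all add: scaleR_matrix_mult_left scaleR_matrix_mult_right)

text \<open>
  Matrix multiplication is a bounded bilinear map, so the powers of \<open>A\<close> grow at most
  geometrically and the scalar exponential series is a majorant.
\<close>
lemma summable_mat_exp: "summable (\<lambda>k. (1 / fact k) *\<^sub>R mat_pow (A :: complex^'m^'m) k)"
proof -
  have "bilinear ((**) :: complex^'m^'m \<Rightarrow> complex^'m^'m \<Rightarrow> complex^'m^'m)"
    unfolding bilinear_def
    by (auto intro!: linearI simp: matrix_matrix_mult_def vec_eq_iff algebra_simps sum.distrib scaleR_right.sum)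
  from bilinear_bounded_pos[OF this] obtain K where K: "K > 0"
      "\<And>X Y. norm ((X :: complex^'m^'m) ** (Y :: complex^'m^'m)) \<le> K * norm X * norm Y"
    by auto
  define C where "C = K * norm A"
  have bound: "norm (mat_pow A k) \<le> C ^ k * norm (mat 1 :: complex^'m^'m)" for k
  proof (induction k)
    case (Suc k)
    have "norm (mat_pow A (Suc k)) \<le> C * norm (mat_pow A k)"
      using K(2)[of A "mat_pow A k"] by (simp add: C_def)
    also have "\<dots> \<le> C * (C ^ k * norm (mat 1 :: complex^'m^'m))"
      using Suc K(1) by (intro mult_left_mono) (auto simp: C_def)
    finally show ?case by (simp add: mult_ac)
  qed simp
  show ?thesis
  proof (rule summable_comparison_test')
    show "summable (\<lambda>k. inverse (fact k) * C ^ k * norm (mat 1 :: complex^'m^'m))"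
      by (intro summable_mult2 summable_exp)
    show "norm ((1 / fact k) *\<^sub>R mat_pow A k)
        \<le> inverse (fact k) * C ^ k * norm (mat 1 :: complex^'m^'m)" for k
      using mult_left_mono[OF bound[of k], of "inverse (fact k)"]
      by (simp add: divide_inverse mult_ac)
  qed
qed

lemma mat_exp_sums: "(\<lambda>k. (1 / fact k) *\<^sub>R mat_pow A k) sums mat_exp A"
  unfolding mat_exp_def using summable_mat_exp by (rule summable_sums)

lemma mat_exp_entry_sums:
  fixes A :: "complex^'m^'m"
  shows
  "(\<lambda>k. mat_pow A k $ i $ j / fact k) sums (mat_exp A $ i $ j)"
proof -
  have "bounded_linear (\<lambda>X :: complex^'m^'m. X $ i $ j)"
    by (rule bounded_linear_compose[OF bounded_linear_vec_nth bounded_linear_vec_nth])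
  from bounded_linear.sums[OF this mat_exp_sums[of A]] show ?thesis
    by (simp add: scaleR_conv_of_real[where 'a=complex] divide_inverse mult.commute)
qed

text \<open>
  Each entry of \<open>mat_exp (t *\<^sub>R A)\<close> is an everywhere convergent scalar power series in \<open>t\<close>, so it
  can be differentiated termwise; shifting the index multiplies the coefficient matrices by \<open>A\<close>.
\<close>
lemma mat_exp_has_vector_derivative:
  fixes A :: "complex^'m^'m"
  shows
  "((\<lambda>t. mat_exp (t *\<^sub>R A) $ i $ j) has_vector_derivative (A ** mat_exp (t *\<^sub>R A)) $ i $ j) (at t)"
proof -
  define c where "c i j k = mat_pow A k $ i $ j / fact k" for i j k
  have entry: "(\<lambda>k. c i j k * complex_of_real s ^ k) sums (mat_exp (s *\<^sub>R A) $ i $ j)" for s i j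
    using mat_exp_entry_sums[of "s *\<^sub>R A" i j]
    unfolding mat_pow_scaleR c_def vector_scaleR_component
    by (simp add: scaleR_conv_of_real[where 'a=complex] mult_ac)
  have summ: "summable (\<lambda>k. c i j k * z ^ k)" for i j z
  proof -
    have "summable (\<lambda>k. c i j k * complex_of_real (norm z + 1) ^ k)"
      using entry sums_summable by blast
    then show ?thesis
      by (rule powser_inside) (auto simp del: of_real_add)
  qed
  have "((\<lambda>z. \<Sum>k. c i j k * z ^ k) has_field_derivative
      (\<Sum>k. diffs (c i j) k * complex_of_real t ^ k)) (at (complex_of_real t))"
    by (rule termdiffs_strong_converges_everywhere[OF summ])
  then have "((\<lambda>t. \<Sum>k. c i j k * complex_of_real t ^ k) has_vector_derivative
      (\<Sum>k. diffs (c i j) k * complex_of_real t ^ k)) (at t)"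
    by (rule has_vector_derivative_real_field)
  also have "(\<lambda>t. \<Sum>k. c i j k * complex_of_real t ^ k) = (\<lambda>t. mat_exp (t *\<^sub>R A) $ i $ j)"
    using sums_unique[OF entry] by simp
  also have "(\<Sum>k. diffs (c i j) k * complex_of_real t ^ k) = (A ** mat_exp (t *\<^sub>R A)) $ i $ j"
  proof (rule sums_unique[symmetric])
    have "diffs (c i j) k = mat_pow A (Suc k) $ i $ j / fact k" for k
      by (simp add: diffs_def c_def del: of_nat_Suc funpow.simps)
    then have "diffs (c i j) k = (\<Sum>l\<in>UNIV. A $ i $ l * c l j k)" for k
      by (simp add: c_def matrix_matrix_mult_def sum_divide_distrib)
    then show "(\<lambda>k. diffs (c i j) k * complex_of_real t ^ k) sums ((A ** mat_exp (t *\<^sub>R A)) $ i $ j)"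
      using sums_sum[of UNIV, OF sums_mult[OF entry]]
      by (simp add: matrix_matrix_mult_def sum_distrib_right mult.assoc)
  qed
  finally show ?thesis .
qed

lemma mat_exp_eigenvector:
  fixes A :: "complex^'m^'m"
  assumes "A *v v = c *s v"
  shows "mat_exp A *v v = exp c *s v"
proof -
  have pow: "mat_pow A k *v v = c ^ k *s v" for k
    by (induction k) (simp_all add: matrix_vector_mul_assoc[symmetric] assms
        matrix_vector_mul_linear_gen vector_smult_assoc vec.scale
        matrix_vector_mult_scaleR vector_scalar_commute mult.commute)
  have "(\<lambda>k. \<Sum>j\<in>UNIV. mat_pow A k $ i $ j / fact k * v $ j)
      sums (\<Sum>j\<in>UNIV. mat_exp A $ i $ j * v $ j)" for i
    by (intro sums_sum sums_mult2 mat_exp_entry_sums)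
  moreover have "(\<Sum>j\<in>UNIV. mat_pow A k $ i $ j / fact k * v $ j) = v $ i * (c ^ k / fact k)" for i k
  proof -
    have "(\<Sum>j\<in>UNIV. mat_pow A k $ i $ j / fact k * v $ j) = (mat_pow A k *v v) $ i / fact k"
      by (simp add: matrix_vector_mult_def sum_divide_distrib)
    then show ?thesis by (simp add: pow)
  qed
  moreover have "(\<lambda>k. v $ i * (c ^ k / fact k)) sums (v $ i * exp c)" for i
    using exp_converges[of c] by (intro sums_mult) (simp add: scaleR_conv_of_real[where 'a=complex] divide_inverse mult.commute)
  ultimately have "(mat_exp A *v v) $ i = v $ i * exp c" for i
    using sums_unique2 by (fastforce simp: matrix_vector_mult_def)
  then show ?thesis by (simp add: vec_eq_iff mult.commute)
qed

text \<open>Every vector is an eigenvector of the zero matrix.\<close>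
lemma mat_exp_0: "mat_exp 0 = (mat 1 :: complex^'m^'m)"
proof -
  have "mat_exp 0 *v v = v" for v :: "complex^'m"
    using mat_exp_eigenvector[of 0 v 0] by simp
  then show ?thesis by (simp add: matrix_eq)
qed

section \<open>The complexified Lie algebra of the special orthogonal group\<close>

lemma SO_iff:
  fixes B :: "complex^'m^'m"
  shows "B \<in> SO \<longleftrightarrow> (\<forall>i j. Im (B $ i $ j) = 0) \<and> transpose B ** B = mat 1 \<and> det B = 1"
  (is "_ \<longleftrightarrow> ?R")
proof -
  define C where "C A = (\<chi> i j. complex_of_real (A $ i $ j))" for A :: "real^'m^'m"
  have mat1: "C (mat 1) = mat 1"
    by (simp add: C_def vec_eq_iff mat_def)
  have inj: "C A = C A' \<longleftrightarrow> A = A'" for A A'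
    by (simp add: C_def vec_eq_iff)
  have mult: "transpose (C A) ** C A = C (transpose A ** A)" for A
    by (simp add: C_def vec_eq_iff matrix_matrix_mult_def transpose_def)
  have det: "det (C A) = of_real (det A)" for A
    by (simp add: C_def det_def)
  have rot: "rotation_matrix A \<longleftrightarrow> transpose (C A) ** C A = mat 1 \<and> det (C A) = 1" for A
    by (simp add: mult mat1[symmetric] inj det rotation_matrix_def orthogonal_matrix del: mat1)
  have SO: "SO = {C A | A. rotation_matrix A}"
    by (simp add: SO_def C_def)
  show ?thesis
  proof
    assume "B \<in> SO"
    then obtain A where "B = C A" "rotation_matrix A" by (auto simp: SO)
    moreover have "Im (C A $ i $ j) = 0" for i j by (simp add: C_def)
    ultimately show ?R using rot[of A] by simp
  next
    assume R: ?R
    have "B = C (\<chi> i j. Re (B $ i $ j))"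
      using R by (simp add: C_def vec_eq_iff complex_eq_iff)
    with R show "B \<in> SO" unfolding SO using rot by (metis (mono_tags, lifting) mem_Collect_eq)
  qed
qed

definition skew :: "(complex^'m^'m) set" where
  "skew = {X. transpose X = - X}"

lemma skewI:
  assumes "\<And>i j. X $ i $ j = - X $ j $ i"
  shows "X \<in> skew"
proof -
  have "transpose X $ i $ j = (- X) $ i $ j" for i j
    using assms[of j i] by (simp add: transpose_def)
  then show ?thesis by (simp add: skew_def vec_eq_iff)
qed

lemma skew_nth:
  assumes "X \<in> skew"
  shows "X $ i $ j = - X $ j $ i"
proof -
  have "X $ i $ j = transpose X $ j $ i" by (simp add: transpose_def)
  with assms show ?thesis by (simp add: skew_def)
qed

lemma cscale_skew: "X \<in> skew \<Longrightarrow> cscale z X \<in> skew"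
proof (rule skewI)
  fix i j
  assume "X \<in> skew"
  then show "cscale z X $ i $ j = - cscale z X $ j $ i"
    using skew_nth[of X i j] by (simp add: cscale_def)
qed

text \<open>
  This derivative gives both inclusions between the Lie algebra and the skew matrices: the Gram
  matrix is constant if \<open>X\<close> is skew, and if it is constant, then its derivative at time 0, which
  is \<open>transpose X + X\<close>, vanishes.
\<close>
lemma gram_mat_exp_has_vector_derivative:
  fixes X :: "complex^'m^'m"
  shows "((\<lambda>t. (transpose (mat_exp (t *\<^sub>R X)) ** mat_exp (t *\<^sub>R X)) $ i $ j) has_vector_derivative
    (transpose (mat_exp (t *\<^sub>R X)) ** (transpose X + X) ** mat_exp (t *\<^sub>R X)) $ i $ j) (at t)"
proof -
  define f where "f s = mat_exp (s *\<^sub>R X)" for s :: real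
  have *: "((\<lambda>s. f s $ k $ i * f s $ k $ j) has_vector_derivative
      (f t $ k $ i * (X ** f t) $ k $ j + (X ** f t) $ k $ i * f t $ k $ j)) (at t)" for k
    unfolding f_def
    by (intro has_vector_derivative_mult mat_exp_has_vector_derivative)
  have "((\<lambda>s. \<Sum>k\<in>UNIV. f s $ k $ i * f s $ k $ j) has_vector_derivative
      (\<Sum>k\<in>UNIV. f t $ k $ i * (X ** f t) $ k $ j + (X ** f t) $ k $ i * f t $ k $ j)) (at t)"
    by (rule has_vector_derivative_sum[OF *])
  also have "(\<Sum>k\<in>UNIV. f t $ k $ i * (X ** f t) $ k $ j + (X ** f t) $ k $ i * f t $ k $ j)
      = (transpose (f t) ** (X ** f t) + transpose (X ** f t) ** f t) $ i $ j"
    by (simp add: matrix_matrix_mult_def transpose_def sum.distrib)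
  also have "transpose (f t) ** (X ** f t) + transpose (X ** f t) ** f t
      = transpose (f t) ** (transpose X + X) ** f t"
    by (simp add: matrix_transpose_mul matrix_add_ldistrib matrix_mul_assoc)
      (simp add: matrix_matrix_mult_def vec_eq_iff algebra_simps sum.distrib)
  also have "(\<lambda>s. \<Sum>k\<in>UNIV. f s $ k $ i * f s $ k $ j) = (\<lambda>s. (transpose (f s) ** f s) $ i $ j)"
    by (simp add: matrix_matrix_mult_def transpose_def)
  finally show ?thesis unfolding f_def .
qed

lemma mat_exp_gram_skew:
  assumes "X \<in> skew"
  shows "transpose (mat_exp X) ** mat_exp X = mat 1"
proof -
  define g where "g i j s = (transpose (mat_exp (s *\<^sub>R X)) ** mat_exp (s *\<^sub>R X)) $ i $ j" for i j s
  have "(g i j has_vector_derivative 0) (at s within UNIV)" for i j s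
    using gram_mat_exp_has_vector_derivative[of X i j s] assms
    unfolding g_def skew_def by (simp add: matrix_matrix_mult_def)
  then have "g i j 1 = g i j 0" for i j
    using has_vector_derivative_zero_constant[of UNIV "g i j"] by (metis UNIV_I convex_UNIV)
  then show ?thesis
    by (simp add: g_def mat_exp_0 vec_eq_iff)
qed

lemma mat_exp_Im_0:
  fixes X :: "complex^'m^'m"
  assumes "\<And>i j. Im (X $ i $ j) = 0"
  shows "Im (mat_exp X $ i $ j) = 0"
proof -
  have pow: "Im (mat_pow X k $ i $ j) = 0" for k i j
  proof (induction k arbitrary: i j)
    case 0
    then show ?case by (simp add: mat_def)
  next
    case (Suc k)
    then show ?case by (simp add: matrix_matrix_mult_def assms)
  qed
  have "(\<lambda>k. Im (mat_pow X k $ i $ j / fact k)) sums Im (mat_exp X $ i $ j)"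
    by (rule sums_Im[OF mat_exp_entry_sums])
  moreover have "Im (mat_pow X k $ i $ j / fact k) = 0" for k
    using pow[of k i j] by (simp add: Im_divide_of_real[of _ "fact k", simplified])
  ultimately show ?thesis
    by (simp add: sums_iff)
qed

text \<open>
  The determinant is \<open>\<plusminus>1\<close> along the path \<open>t \<mapsto> mat_exp (t *\<^sub>R X)\<close>, because the Gram
  matrix is the identity there; it is continuous in \<open>t\<close> and equals 1 at \<open>t = 0\<close>.
\<close>
lemma det_mat_exp_skew:
  fixes X :: "complex^'m^'m"
  assumes real: "\<And>i j. Im (X $ i $ j) = 0" and skew: "X \<in> skew"
  shows "det (mat_exp X) = 1"
proof -
  define d where "d s = det (mat_exp (s *\<^sub>R X))" for s :: real
  have "continuous_on UNIV (\<lambda>s. mat_exp (s *\<^sub>R X) $ i $ j)" for i j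
    using mat_exp_has_vector_derivative has_vector_derivative_continuous
    by (metis continuous_at_imp_continuous_on)
  then have cont: "continuous_on UNIV d"
    unfolding d_def det_def by (intro continuous_on_sum continuous_on_mult continuous_on_const continuous_on_prod)
  have sq: "d s * d s = 1" for s
  proof -
    have "s *\<^sub>R X \<in> skew" using skew by (simp add: skew_def transpose_scalar)
    from mat_exp_gram_skew[OF this] show ?thesis
      unfolding d_def by (metis det_I det_mul det_transpose)
  qed
  have "d s \<in> {1, -1}" for s
    using sq[of s] by (metis insert_iff square_eq_1_iff)
  then have "d ` UNIV \<subseteq> {1, -1}" by auto
  moreover have "connected (d ` UNIV)"
    using cont by (rule connected_continuous_image) simp
  ultimately have "\<exists>a. d ` UNIV \<subseteq> {a}"
    using connected_finite_iff_sing[of "d ` UNIV"] finite_subset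
    by (metis finite.intros empty_subsetI subset_refl)
  then obtain a where "range d \<subseteq> {a}" ..
  then have "d 1 = a" "d 0 = a" by (auto simp: image_subset_iff)
  then show ?thesis by (simp add: d_def mat_exp_0)
qed

lemma lie_algebra_SO:
  "lie_algebra SO = {X \<in> skew. \<forall>i j. Im (X $ i $ j) = 0}"
proof (intro equalityI subsetI)
  fix X :: "complex^'m^'m" assume "X \<in> lie_algebra SO"
  then have SO: "mat_exp (t *\<^sub>R X) \<in> SO" for t by (simp add: lie_algebra_def)
  have "X $ i $ j = cnj (X $ i $ j)" for i j
  proof -
    have "((\<lambda>t. mat_exp (t *\<^sub>R X) $ i $ j) has_vector_derivative X $ i $ j) (at 0)"
      using mat_exp_has_vector_derivative[of X i j 0] by (simp add: mat_exp_0)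
    moreover from this have "((\<lambda>t. cnj (mat_exp (t *\<^sub>R X) $ i $ j)) has_vector_derivative cnj (X $ i $ j)) (at 0)"
      by (rule has_vector_derivative_cnj)
    moreover have "(\<lambda>t. cnj (mat_exp (t *\<^sub>R X) $ i $ j)) = (\<lambda>t. mat_exp (t *\<^sub>R X) $ i $ j)"
      using SO by (auto simp: SO_iff complex_eq_iff fun_eq_iff)
    ultimately show ?thesis using vector_derivative_unique_at by metis
  qed
  then have "Im (X $ i $ j) = 0" for i j
    by (metis cnj.sel(2) equal_neg_zero)
  moreover have "(transpose X + X) $ i $ j = 0" for i j
  proof -
    have "((\<lambda>t. (transpose (mat_exp (t *\<^sub>R X)) ** mat_exp (t *\<^sub>R X)) $ i $ j)
        has_vector_derivative (transpose X + X) $ i $ j) (at 0)"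
      using gram_mat_exp_has_vector_derivative[of X i j 0] by (simp add: mat_exp_0)
    moreover have "(\<lambda>t. (transpose (mat_exp (t *\<^sub>R X)) ** mat_exp (t *\<^sub>R X)) $ i $ j) = (\<lambda>_. mat 1 $ i $ j)"
      using SO by (simp add: SO_iff)
    ultimately show ?thesis
      using vector_derivative_unique_at has_vector_derivative_const by metis
  qed
  then have "X \<in> skew"
    by (simp add: skew_def vec_eq_iff eq_neg_iff_add_eq_0)
  ultimately show "X \<in> {X \<in> skew. \<forall>i j. Im (X $ i $ j) = 0}" by simp
next
  fix X :: "complex^'m^'m" assume X: "X \<in> {X \<in> skew. \<forall>i j. Im (X $ i $ j) = 0}"
  have "mat_exp (t *\<^sub>R X) \<in> SO" for t
  proof -
    have tX: "t *\<^sub>R X \<in> skew" "\<And>i j. Im ((t *\<^sub>R X) $ i $ j) = 0"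
      using X by (simp_all add: skew_def transpose_scalar)
    then show ?thesis
      by (simp add: SO_iff mat_exp_Im_0 mat_exp_gram_skew det_mat_exp_skew)
  qed
  then show "X \<in> lie_algebra SO" by (simp add: lie_algebra_def)
qed

text \<open>
  The entrywise real and imaginary parts of a complex skew matrix are real skew matrices.
\<close>
lemma complexification_lie_algebra_SO: "complexification (lie_algebra SO) = skew"
proof (intro equalityI subsetI)
  fix Z :: "complex^'m^'m" assume "Z \<in> complexification (lie_algebra SO)"
  then obtain X Y where "Z = X + cscale \<i> Y" "X \<in> skew" "Y \<in> skew"
    by (auto simp: complexification_def lie_algebra_SO)
  moreover from this have "Z $ i $ j = - Z $ j $ i" for i j
    using skew_nth[of X i j] skew_nth[of Y i j] by (simp add: cscale_def)
  ultimately show "Z \<in> skew" by (blast intro: skewI)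
next
  fix Z :: "complex^'m^'m" assume Z: "Z \<in> skew"
  define X Y where "X = (\<chi> i j. complex_of_real (Re (Z $ i $ j)))"
    and "Y = (\<chi> i j. complex_of_real (Im (Z $ i $ j)))"
  have "Z = X + cscale \<i> Y"
    by (simp add: X_def Y_def cscale_def vec_eq_iff complex_eq_iff)
  moreover have "X \<in> skew" "Y \<in> skew"
  proof (rule_tac [!] skewI)
    fix i j
    show "X $ i $ j = - X $ j $ i" "Y $ i $ j = - Y $ j $ i"
      using skew_nth[OF Z, of i j] by (simp_all add: X_def Y_def)
  qed
  moreover from this have "X \<in> lie_algebra SO" "Y \<in> lie_algebra SO"
    by (simp_all add: lie_algebra_SO X_def Y_def)
  ultimately show "Z \<in> complexification (lie_algebra SO)"
    unfolding complexification_def by blast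
qed

section \<open>Linear algebra over the complex numbers\<close>

lemma cscale_mult_vec: "cscale c A *v v = c *s (A *v v)"
  by (simp add: cscale_def matrix_vector_mult_def vec_eq_iff sum_distrib_left mult.assoc)

lemma ad_mult_vec: "ad A B *v v = A *v (B *v v) - B *v (A *v v)"
  by (simp add: ad_def matrix_vector_mult_diff_rdistrib matrix_vector_mul_assoc)

lemma bilinQ_diff_right: "bilinQ v (w - w') = bilinQ v w - bilinQ v w'"
  by (simp add: bilinQ_def algebra_simps sum_subtractf)

lemma bilinQ_add_right: "bilinQ v (w + w') = bilinQ v w + bilinQ v w'"
  by (simp add: bilinQ_def algebra_simps sum.distrib)

lemma bilinQ_scale_right: "bilinQ v (c *s w) = c * bilinQ v w"
  by (simp add: bilinQ_def algebra_simps sum_distrib_left)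

lemma bilinQ_sum_right: "bilinQ v (\<Sum>i\<in>S. f i) = (\<Sum>i\<in>S. bilinQ v (f i))"
  unfolding bilinQ_def by (simp add: sum_component sum_distrib_left) (rule sum.swap)

lemma mult_vec_sum: "(A :: complex^'m^'m) *v (\<Sum>i\<in>S. f i) = (\<Sum>i\<in>S. A *v f i)"
  by (induction S rule: infinite_finite_induct) (simp_all add: matrix_vector_right_distrib)

lemma sum_mult_vec: "(\<Sum>i\<in>S. A i :: complex^'m^'m) *v v = (\<Sum>i\<in>S. A i *v v)"
  by (induction S rule: infinite_finite_induct) (simp_all add: matrix_vector_mult_add_rdistrib)

lemma mult_vec_scale: "(A :: complex^'m^'m) *v (c *s v) = c *s (A *v v)"
  by (simp add: vec_eq_iff matrix_vector_mult_def sum_distrib_left mult_ac)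

lemma scaleR_mult_vec: "(r *\<^sub>R (A :: complex^'m^'m)) *v v = complex_of_real r *s (A *v v)"
  by (simp add: vec_eq_iff matrix_vector_mult_def sum_distrib_left scaleR_conv_of_real[where 'a=complex] mult_ac)

section \<open>Arithmetic of the last two marks\<close>

lemma four_dvd_pair_iff:
  fixes a b :: int
  shows "4 dvd b - a \<and> 4 dvd a + b \<longleftrightarrow> even a \<and> even b \<and> 4 dvd a + b"
  by presburger

text \<open>
  Two even decreases below 4 whose sum is divisible by 4 are both 0 or both 2, and the latter
  needs both entries to be at least 2.
\<close>
lemma minimal_pair:
  fixes a b a' b' :: nat
  assumes "a < 4" "b < 4" "\<not> (2 \<le> a \<and> 2 \<le> b)"
    and "a' \<le> a" "even (a - a')" "b' \<le> b" "even (b - b')" "4 dvd (a - a') + (b - b')"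
  shows "a' = a \<and> b' = b"
  using assms by presburger

lemma minimal_pair_cases:
  fixes a b :: nat
  assumes "even (a + b)" "a < 4" "b < 4" "\<not> (2 \<le> a \<and> 2 \<le> b)"
  shows "a = 0 \<and> b = 0 \<or> a = 2 \<and> b = 0 \<or> a = 0 \<and> b = 2 \<or>
    a = 1 \<and> b = 1 \<or> a = 3 \<and> b = 1 \<or> a = 1 \<and> b = 3"
  using assms by presburger

section \<open>The isotropic basis and the torus\<close>

locale isotropic_frame =
  fixes n :: nat and e :: "nat \<Rightarrow> complex^'m"
  assumes two_le_n: "2 \<le> n"
    and basis: "isotropic_basis n e"
begin

text \<open>
  The involution of the indices that matches \<open>e\<^sub>i\<close> with \<open>e\<^bsub>n+i\<^esub>\<close>, so that
  \<open>e (opp k)\<close>, paired through \<open>bilinQ\<close>, is the coordinate functional dual to \<open>e k\<close>.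
\<close>
definition opp :: "nat \<Rightarrow> nat" where
  "opp k = (if k \<le> n then n + k else k - n)"

lemma opp_in [simp]: "k \<in> {1..2 * n} \<Longrightarrow> opp k \<in> {1..2 * n}"
  by (auto simp: opp_def)

lemma opp_bounds [simp]:
  assumes "k \<in> {1..2 * n}"
  shows "Suc 0 \<le> opp k" "opp k \<le> 2 * n"
  using opp_in[OF assms] by auto

lemma opp_opp [simp]: "k \<in> {1..2 * n} \<Longrightarrow> opp (opp k) = k"
  by (auto simp: opp_def)

lemma opp_eq_iff: "k \<in> {1..2 * n} \<Longrightarrow> l \<in> {1..2 * n} \<Longrightarrow> opp k = opp l \<longleftrightarrow> k = l"
  by (metis opp_opp)

lemma bilinQ_basis:
  assumes "k \<in> {1..2 * n}" "l \<in> {1..2 * n}"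
  shows "bilinQ (e k) (e l) = (if l = opp k then 1 else 0)"
proof -
  have "l = n + k \<or> k = n + l \<longleftrightarrow> l = opp k"
    using assms by (auto simp: opp_def)
  with basis assms show ?thesis by (simp add: isotropic_basis_def)
qed

lemma bilinQ_opp_basis:
  assumes "k \<in> {1..2 * n}" "l \<in> {1..2 * n}"
  shows "bilinQ (e (opp k)) (e l) = (if k = l then 1 else 0)"
  using bilinQ_basis[OF opp_in[OF assms(1)] assms(2)] assms by simp

text \<open>
  Both sides are linear in \<open>v\<close>, so it is enough to compare them on the basis, which spans.
\<close>
lemma basis_expansion: "v = (\<Sum>k\<in>{1..2 * n}. bilinQ (e (opp k)) v *s e k)"
proof -
  let ?f = "\<lambda>v. \<Sum>k\<in>{1..2 * n}. bilinQ (e (opp k)) v *s e k"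
  have "v \<in> vec.span (e ` {1..2 * n})"
    using basis by (simp add: isotropic_basis_def)
  then show "v = ?f v"
  proof (induction rule: vec.span_induct_alt)
    case base
    then show ?case by (simp add: bilinQ_def)
  next
    case (step c x y)
    then obtain l where l: "x = e l" "l \<in> {1..2 * n}" by auto
    have "?f (c *s x) = (\<Sum>k\<in>{1..2 * n}. if k = l then c *s x else 0)"
      using l by (intro sum.cong) (auto simp: bilinQ_scale_right bilinQ_opp_basis)
    then have "?f (c *s x) = c *s x" using l(2) by simp
    moreover have "?f (c *s x + y) = ?f (c *s x) + ?f y"
      by (simp add: bilinQ_add_right vector_sadd_rdistrib sum.distrib)
    ultimately show ?case using step by simp
  qed
qed

lemma mult_vec_expansion:
  fixes A :: "complex^'m^'m"
  shows "A *v v = (\<Sum>k\<in>{1..2 * n}. bilinQ (e (opp k)) v *s (A *v e k))"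
  by (subst basis_expansion[of v]) (simp add: mult_vec_sum mult_vec_scale)

lemma matrix_eqI:
  fixes A B :: "complex^'m^'m"
  assumes "\<And>k. k \<in> {1..2 * n} \<Longrightarrow> A *v e k = B *v e k"
  shows "A = B"
proof -
  have "A *v v = B *v v" for v
    using assms by (simp add: mult_vec_expansion[of A v] mult_vec_expansion[of B v])
  then show ?thesis by (simp add: matrix_eq)
qed

lemma basis_neq_0: "k \<in> {1..2 * n} \<Longrightarrow> e k \<noteq> 0"
  using bilinQ_opp_basis[of k k] by (auto simp: bilinQ_def)

text \<open>The rank one matrix \<open>e\<^sub>a e\<^sub>b\<^sup>T\<close>.\<close>
definition outer :: "nat \<Rightarrow> nat \<Rightarrow> complex^'m^'m" where
  "outer a b = (\<chi> i j. e a $ i * e b $ j)"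

lemma outer_mult_vec: "outer a b *v v = bilinQ (e b) v *s e a"
  by (simp add: outer_def bilinQ_def matrix_vector_mult_def vec_eq_iff sum_distrib_left mult_ac)

text \<open>
  The definite description is resolved by an explicit matrix with the prescribed eigenvalues,
  the sum of the \<open>d k\<close> times the coordinate projections; a matrix is determined by its values on
  the basis.
\<close>
lemma diag_in_basis_mult_vec:
  assumes "k \<in> {1..2 * n}"
  shows "diag_in_basis (2 * n) e d *v e k = d k *s e k"
proof -
  define A where "A = (\<Sum>k\<in>{1..2 * n}. cscale (d k) (outer k (opp k)))"
  have A: "A *v e l = d l *s e l" if "l \<in> {1..2 * n}" for l
  proof -
    have "A *v e l = (\<Sum>k\<in>{1..2 * n}. if k = l then d l *s e l else 0)"
      unfolding A_def sum_mult_vec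
      using that by (intro sum.cong) (auto simp: cscale_mult_vec outer_mult_vec bilinQ_opp_basis)
    then show ?thesis using that by simp
  qed
  have "\<forall>k\<in>{1..2 * n}. diag_in_basis (2 * n) e d *v e k = d k *s e k"
    unfolding diag_in_basis_def
  proof (rule theI)
    show "\<forall>k\<in>{1..2 * n}. A *v e k = d k *s e k" using A by blast
  next
    fix B :: "complex^'m^'m" assume "\<forall>k\<in>{1..2 * n}. B *v e k = d k *s e k"
    then show "B = A" using A by (intro matrix_eqI) simp
  qed
  with assms show ?thesis by blast
qed

definition torus_elt :: "(nat \<Rightarrow> real) \<Rightarrow> complex^'m^'m" where
  "torus_elt c = (\<Sum>i=1..n. c i *\<^sub>R D_E n e i)"

text \<open>The eigenvalue of \<open>torus_elt c\<close> on \<open>e k\<close>, divided by \<open>\<i>\<close>.\<close>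
definition weight :: "(nat \<Rightarrow> real) \<Rightarrow> nat \<Rightarrow> real" where
  "weight c k = (if k \<le> n then c k else - c (k - n))"

lemma weight_opp: "k \<in> {1..2 * n} \<Longrightarrow> weight c (opp k) = - weight c k"
  by (auto simp: weight_def opp_def)

lemma torus_elt_mult_basis:
  assumes k: "k \<in> {1..2 * n}"
  shows "torus_elt c *v e k = (\<i> * weight c k) *s e k"
proof -
  define i where "i = (if k \<le> n then k else k - n)"
  have i: "i \<in> {1..n}" using k by (auto simp: i_def)
  have "torus_elt c *v e k = (\<Sum>j=1..n. (c j * (if k = j then \<i> else if k = n + j then - \<i> else 0)) *s e k)"
    unfolding torus_elt_def D_E_def sum_mult_vec scaleR_mult_vec diag_in_basis_mult_vec[OF k]
    by (simp add: vector_smult_assoc)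
  also have "\<dots> = (\<Sum>j=1..n. if j = i then (\<i> * weight c k) *s e k else 0)"
    using k by (intro sum.cong) (auto simp: i_def weight_def)
  finally show ?thesis using i by simp
qed

lemma torus_elt_eqD:
  assumes "torus_elt c = torus_elt c'" "i \<in> {1..n}"
  shows "c i = c' i"
proof -
  have "(\<i> * weight c i) *s e i = (\<i> * weight c' i) *s e i"
    using assms torus_elt_mult_basis[of i c] torus_elt_mult_basis[of i c'] by auto
  moreover have "e i \<noteq> 0" using assms(2) by (intro basis_neq_0) auto
  ultimately show ?thesis using assms(2) by (simp add: weight_def)
qed

lemma torus_elt_cong: "(\<And>i. i \<in> {1..n} \<Longrightarrow> c i = c' i) \<Longrightarrow> torus_elt c = torus_elt c'"
  by (simp add: torus_elt_def)

lemma torus_elt_diff: "torus_elt c - torus_elt c' = torus_elt (\<lambda>i. c i - c' i)"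
  by (simp add: torus_elt_def scaleR_diff_left sum_subtractf)

lemma D_torus_eq: "D_torus n e = range torus_elt"
  by (auto simp: D_torus_def torus_elt_def)

text \<open>
  The exponential is diagonal in the basis with entries \<open>exp (\<i> s w)\<close> for the weights \<open>w\<close>,
  and the weights are the \<open>c i\<close> and their negatives.
\<close>
lemma mat_exp_torus_elt_eq_1_iff:
  "mat_exp (s *\<^sub>R torus_elt c) = mat 1 \<longleftrightarrow> (\<forall>i\<in>{1..n}. \<exists>z::int. s * c i = 2 * pi * z)"
proof -
  have exp_basis: "mat_exp (s *\<^sub>R torus_elt c) *v e k = exp (\<i> * (s * weight c k)) *s e k"
    if "k \<in> {1..2 * n}" for k
    using that by (intro mat_exp_eigenvector)
      (simp add: scaleR_mult_vec torus_elt_mult_basis vector_smult_assoc mult_ac)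
  have exp1: "exp (\<i> * complex_of_real x) = 1 \<longleftrightarrow> (\<exists>z::int. x = 2 * pi * z)" for x
    by (auto simp: exp_eq_1 mult_ac)
  have "mat_exp (s *\<^sub>R torus_elt c) = mat 1 \<longleftrightarrow>
      (\<forall>k\<in>{1..2 * n}. mat_exp (s *\<^sub>R torus_elt c) *v e k = mat 1 *v e k)"
    by (metis matrix_eqI)
  also have "\<dots> \<longleftrightarrow> (\<forall>k\<in>{1..2 * n}. exp (\<i> * (s * weight c k)) *s e k = 1 *s e k)"
    by (intro ball_cong refl) (simp only: exp_basis matrix_vector_mul_lid vector_smult_lid)
  also have "\<dots> \<longleftrightarrow> (\<forall>k\<in>{1..2 * n}. exp (\<i> * (s * weight c k)) = 1)"
    by (intro ball_cong refl) (simp only: vector_mul_rcancel, simp add: basis_neq_0)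
  also have "\<dots> \<longleftrightarrow> (\<forall>k\<in>{1..2 * n}. \<exists>z::int. s * weight c k = 2 * pi * z)"
    using exp1[of "s * weight c _"] by (simp only: of_real_mult)
  also have "\<dots> \<longleftrightarrow> (\<forall>i\<in>{1..n}. \<exists>z::int. s * c i = 2 * pi * z)"
  proof (intro iffI ballI)
    fix i assume "\<forall>k\<in>{1..2 * n}. \<exists>z::int. s * weight c k = 2 * pi * z" "i \<in> {1..n}"
    then show "\<exists>z::int. s * c i = 2 * pi * z"
      by (auto simp: weight_def dest!: bspec[of _ _ i])
  next
    fix k assume *: "\<forall>i\<in>{1..n}. \<exists>z::int. s * c i = 2 * pi * z" and k: "k \<in> {1..2 * n}"
    show "\<exists>z::int. s * weight c k = 2 * pi * z"
    proof (cases "k \<le> n")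
      case True
      then show ?thesis using * k by (auto simp: weight_def)
    next
      case False
      then have "k - n \<in> {1..n}" using k by auto
      with * obtain z :: int where "s * c (k - n) = 2 * pi * z" by blast
      then show ?thesis using False by (intro exI[of _ "- z"]) (simp add: weight_def)
    qed
  qed
  finally show ?thesis .
qed

text \<open>
  A torus element is skew for \<open>bilinQ\<close>; this evaluates it next to a functional.
\<close>
lemma bilinQ_torus_elt:
  assumes "a \<in> {1..2 * n}"
  shows "bilinQ (e a) (torus_elt c *v v) = - (\<i> * weight c a) * bilinQ (e a) v"
proof -
  have "bilinQ (e a) (torus_elt c *v v)
      = (\<Sum>k\<in>{1..2 * n}. bilinQ (e (opp k)) v * (\<i> * weight c k) * bilinQ (e a) (e k))"
    by (subst mult_vec_expansion) (simp add: bilinQ_sum_right bilinQ_scale_right torus_elt_mult_basis)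
  also have "\<dots> = (\<Sum>k\<in>{1..2 * n}. if k = opp a then - (\<i> * weight c a) * bilinQ (e a) v else 0)"
    using assms by (intro sum.cong) (auto simp: bilinQ_basis weight_opp)
  finally show ?thesis using assms by simp
qed

section \<open>Root vectors and the order on the torus\<close>

definition root_vector :: "nat \<Rightarrow> nat \<Rightarrow> complex^'m^'m" where
  "root_vector a b = outer a b - outer b a"

lemma root_vector_skew: "root_vector a b \<in> skew"
  by (rule skewI) (simp add: root_vector_def outer_def)

lemma root_vector_ad_eigenspace:
  assumes "a \<in> {1..2 * n}" "b \<in> {1..2 * n}" "weight c a + weight c b = of_int j"
  shows "cscale z (root_vector a b) \<in> ad_eigenspace SO (torus_elt c) j"
proof -
  have sum: "complex_of_real (weight c a) + complex_of_real (weight c b) = of_int j"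
    using assms(3) by (metis of_real_add of_real_of_int_eq)
  have "ad (torus_elt c) (cscale z (root_vector a b)) *v v
      = cscale (\<i> * of_int j) (cscale z (root_vector a b)) *v v" for v
    using assms(1,2)
    by (simp add: ad_mult_vec cscale_mult_vec root_vector_def matrix_vector_mult_diff_rdistrib
        outer_mult_vec bilinQ_torus_elt mult_vec_scale matrix_vector_mult_diff_distrib
        torus_elt_mult_basis vec_eq_iff sum[symmetric] algebra_simps)
  then show ?thesis
    by (simp add: ad_eigenspace_def complexification_lie_algebra_SO cscale_skew root_vector_skew matrix_eq)
qed

text \<open>The coefficient of \<open>outer a b\<close> in the expansion of \<open>Y\<close>.\<close>
definition matrix_coeff :: "nat \<Rightarrow> nat \<Rightarrow> complex^'m^'m \<Rightarrow> complex" where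
  "matrix_coeff a b Y = bilinQ (e (opp a)) (Y *v e (opp b))"

text \<open>
  The \<open>(a, b)\<close> coefficient of \<open>ad (torus_elt c) Y\<close> is \<open>\<i>\<close> times the sum of the weights of
  \<open>a\<close> and \<open>b\<close> times that of \<open>Y\<close>. An eigenvector therefore only involves the root
  vectors that belong to its own eigenvalue.
\<close>
lemma matrix_coeff_ad_eigenspace:
  assumes "a \<in> {1..2 * n}" "b \<in> {1..2 * n}" "Y \<in> ad_eigenspace SO (torus_elt c) j"
    and "matrix_coeff a b Y \<noteq> 0"
  shows "weight c a + weight c b = of_int j"
proof -
  have "bilinQ (e (opp a)) (ad (torus_elt c) Y *v e (opp b)) = \<i> * of_int j * matrix_coeff a b Y"
    using assms(3) by (simp add: ad_eigenspace_def cscale_mult_vec bilinQ_scale_right matrix_coeff_def)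
  moreover have "bilinQ (e (opp a)) (ad (torus_elt c) Y *v e (opp b))
      = \<i> * (weight c a + weight c b) * matrix_coeff a b Y"
    unfolding ad_mult_vec bilinQ_diff_right bilinQ_torus_elt[OF opp_in[OF assms(1)]]
      torus_elt_mult_basis[OF opp_in[OF assms(2)]] mult_vec_scale bilinQ_scale_right
    by (simp add: weight_opp[OF assms(1)] weight_opp[OF assms(2)] matrix_coeff_def algebra_simps)
  ultimately have "complex_of_real (weight c a + weight c b) = complex_of_real (of_int j)"
    using assms(4) by simp
  then show ?thesis by (simp only: of_real_eq_iff)
qed

lemma matrix_expansion:
  "Y = (\<Sum>a\<in>{1..2 * n}. \<Sum>b\<in>{1..2 * n}. cscale (matrix_coeff a b Y) (outer a b))"
proof (rule matrix_eqI)
  fix l assume l: "l \<in> {1..2 * n}"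
  have *: "(\<Sum>b\<in>{1..2 * n}. cscale (matrix_coeff a b Y) (outer a b) *v e l)
      = bilinQ (e (opp a)) (Y *v e l) *s e a" for a
  proof -
    have "(\<Sum>b\<in>{1..2 * n}. cscale (matrix_coeff a b Y) (outer a b) *v e l)
        = (\<Sum>b\<in>{1..2 * n}. if b = opp l then bilinQ (e (opp a)) (Y *v e l) *s e a else 0)"
      using l by (intro sum.cong)
        (auto simp: cscale_mult_vec outer_mult_vec bilinQ_basis matrix_coeff_def)
    then show ?thesis using l by simp
  qed
  show "Y *v e l = (\<Sum>a\<in>{1..2 * n}. \<Sum>b\<in>{1..2 * n}. cscale (matrix_coeff a b Y) (outer a b)) *v e l"
    unfolding sum_mult_vec * by (rule basis_expansion)
qed

text \<open>
  Averaging the expansion of \<open>Y\<close> in the matrices \<open>outer a b\<close> with its negative transpose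
  replaces these by root vectors, which stay inside the complexified Lie algebra.
\<close>
lemma skew_expansion:
  assumes "Y \<in> skew"
  shows "Y = (1 / 2) *\<^sub>R (\<Sum>a\<in>{1..2 * n}. \<Sum>b\<in>{1..2 * n}. cscale (matrix_coeff a b Y) (root_vector a b))"
proof -
  let ?S = "\<Sum>a\<in>{1..2 * n}. \<Sum>b\<in>{1..2 * n}. cscale (matrix_coeff a b Y) (outer a b)"
  have "2 *\<^sub>R Y = Y - transpose Y"
    using assms by (simp add: skew_def scaleR_2)
  also have "\<dots> = ?S - transpose ?S"
    using matrix_expansion[of Y] by simp
  also have "\<dots> = (\<Sum>a\<in>{1..2 * n}. \<Sum>b\<in>{1..2 * n}. cscale (matrix_coeff a b Y) (root_vector a b))"
    by (simp add: vec_eq_iff transpose_def sum_component cscale_def root_vector_def outer_def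
        algebra_simps sum_subtractf)
  finally show ?thesis by (metis (no_types, lifting) scaleR_one scaleR_scaleR nonzero_eq_divide_eq zero_neq_numeral)
qed

definition dominant :: "(nat \<Rightarrow> real) \<Rightarrow> bool" where
  "dominant c \<longleftrightarrow> (\<forall>i j. 1 \<le> i \<and> i < j \<and> j \<le> n \<longrightarrow> c i + c j \<ge> 0 \<and> c i - c j \<ge> 0)"

definition integer_coords :: "(nat \<Rightarrow> real) \<Rightarrow> bool" where
  "integer_coords c \<longleftrightarrow> (\<forall>i\<in>{1..n}. c i \<in> \<int>)"

lemma weight_in_Ints: "integer_coords c \<Longrightarrow> k \<in> {1..2 * n} \<Longrightarrow> weight c k \<in> \<int>"
  by (auto simp: integer_coords_def weight_def intro!: bspec[of "{1..n}" "\<lambda>i. c i \<in> \<int>" "k - n"])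

text \<open>
  For \<open>b = opp a\<close> the sum of the two weights is 0; otherwise it is the value of a root.
  A positive root decreases from \<open>c\<close> to \<open>c'\<close> because their difference is dominant, and a
  negative root is nonpositive on the dominant \<open>c'\<close>.
\<close>
lemma weight_sum_le:
  assumes d: "dominant (\<lambda>i. c i - c' i)" and c': "dominant c'"
    and ab: "a \<in> {1..2 * n}" "b \<in> {1..2 * n}" "a \<noteq> b"
  shows "weight c' a + weight c' b \<le> max 0 (weight c a + weight c b)"
proof -
  have diff: "weight c' a + weight c' b \<le> 0 \<or>
      weight c' a + weight c' b \<le> weight c a + weight c b" if "a < b" "a \<in> {1..2 * n}" "b \<in> {1..2 * n}" for a b
  proof -
    consider "b \<le> n" | "a \<le> n" "n < b" "a < b - n" | "a \<le> n" "n < b" "a = b - n"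
      | "a \<le> n" "n < b" "b - n < a" | "n < a"
      using \<open>a < b\<close> by linarith
    then show ?thesis
    proof cases
      case 1
      then show ?thesis
        using d[unfolded dominant_def, rule_format, of a b] that by (simp add: weight_def)
    next
      case 2
      then show ?thesis
        using d[unfolded dominant_def, rule_format, of a "b - n"] that
        le_diff_conv[of b n n] by (auto simp: weight_def)
    next
      case 3
      then show ?thesis by (simp add: weight_def)
    next
      case 4
      then show ?thesis
        using c'[unfolded dominant_def, rule_format, of "b - n" a] that by (simp add: weight_def)
    next
      case 5
      then have "1 \<le> a - n \<and> a - n < b - n \<and> b - n \<le> n"
        using that by auto
      then show ?thesis
        using c'[unfolded dominant_def, rule_format, of "a - n" "b - n"] 5 that
        by (simp add: weight_def)
    qed
  qed
  have "a < b \<or> b < a" using ab(3) by linarith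
  then show ?thesis using diff[of a b] diff[of b a] ab(1,2) by (auto simp: le_max_iff_disj add.commute)
qed

text \<open>
  The vanishing of a coefficient is a linear condition, and it holds on all the eigenspaces that
  span the parabolic, since their eigenvalues are at most \<open>i\<close>.
\<close>
lemma parabolic_matrix_coeff_eq_0:
  assumes "a \<in> {1..2 * n}" "b \<in> {1..2 * n}" "i < weight c a + weight c b"
    and "Y \<in> parabolic SO (torus_elt c) i"
  shows "matrix_coeff a b Y = 0"
proof -
  have "subspace {Y. matrix_coeff a b Y = 0}"
    by (auto simp: subspace_def matrix_coeff_def matrix_vector_mult_add_rdistrib scaleR_mult_vec
        bilinQ_add_right bilinQ_scale_right) (simp add: bilinQ_def)
  moreover have "(\<Union>j\<in>{..i}. ad_eigenspace SO (torus_elt c) j) \<subseteq> {Y. matrix_coeff a b Y = 0}"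
    using matrix_coeff_ad_eigenspace[OF assms(1,2)] assms(3) by fastforce
  ultimately show ?thesis
    using assms(4) span_minimal unfolding parabolic_def by blast
qed

text \<open>
  The root vector for \<open>a\<close> and \<open>b\<close> lies in the parabolic of \<open>torus_elt c\<close> at the level of its
  own eigenvalue, hence in that of \<open>torus_elt c'\<close>; its coefficient at \<open>(a, b)\<close> is 1 and would
  vanish there if its eigenvalue for \<open>torus_elt c'\<close> were larger.
\<close>
lemma canon_le_torus_elt_imp:
  assumes c: "dominant c" "integer_coords c"
    and le: "canon_le SO (torus_elt c) (torus_elt c')"
    and ab: "a \<in> {1..2 * n}" "b \<in> {1..2 * n}" "a \<noteq> b" "weight c a + weight c b \<ge> 0"
  shows "weight c' a + weight c' b \<le> weight c a + weight c b"
proof -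
  have "weight c a + weight c b \<in> \<int>"
    using c(2) ab by (intro Ints_add weight_in_Ints)
  then obtain m where m: "weight c a + weight c b = of_int m" by (elim Ints_cases)
  with ab(4) have "m \<ge> 0" by simp
  have "cscale 1 (root_vector a b) \<in> ad_eigenspace SO (torus_elt c) m"
    using ab m by (intro root_vector_ad_eigenspace)
  then have "cscale 1 (root_vector a b) \<in> parabolic SO (torus_elt c) m"
    unfolding parabolic_def by (intro span_base) blast
  with le \<open>m \<ge> 0\<close> have "cscale 1 (root_vector a b) \<in> parabolic SO (torus_elt c') m"
    unfolding canon_le_def by blast
  moreover have "matrix_coeff a b (cscale 1 (root_vector a b)) = 1"
    using ab by (simp add: matrix_coeff_def root_vector_def cscale_mult_vec
        matrix_vector_mult_diff_rdistrib outer_mult_vec bilinQ_diff_right bilinQ_scale_right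
        bilinQ_basis bilinQ_opp_basis opp_eq_iff)
  ultimately show ?thesis
    using parabolic_matrix_coeff_eq_0[OF ab(1,2)] m by (metis linorder_not_le zero_neq_one)
qed

text \<open>
  From left to right, test the order on the root vectors of the positive roots. Conversely, expand
  an eigenvector of \<open>ad (torus_elt c)\<close> in root vectors: those that occur all have its eigenvalue,
  and \<open>weight_sum_le\<close> bounds their eigenvalues for \<open>torus_elt c'\<close>, provided the level is
  nonnegative.
\<close>
lemma canon_le_torus_elt_iff:
  assumes c: "dominant c" "integer_coords c" and c': "dominant c'" "integer_coords c'"
  shows "canon_le SO (torus_elt c) (torus_elt c') \<longleftrightarrow> dominant (\<lambda>i. c i - c' i)"
proof
  assume le: "canon_le SO (torus_elt c) (torus_elt c')"
  show "dominant (\<lambda>i. c i - c' i)"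
    unfolding dominant_def
  proof (intro allI impI)
    fix i j assume ij: "1 \<le> i \<and> i < j \<and> j \<le> n"
    then have c_ij: "c i + c j \<ge> 0" "c i - c j \<ge> 0"
      using c(1) unfolding dominant_def by blast+
    have "c' i + c' j \<le> c i + c j"
      using canon_le_torus_elt_imp[OF c le, of i j] ij c_ij by (simp add: weight_def)
    moreover have "c' i - c' j \<le> c i - c j"
      using canon_le_torus_elt_imp[OF c le, of i "n + j"] ij c_ij by (simp add: weight_def)
    ultimately show "c i - c' i + (c j - c' j) \<ge> 0 \<and> c i - c' i - (c j - c' j) \<ge> 0" by simp
  qed
next
  assume d: "dominant (\<lambda>i. c i - c' i)"
  have sub: "ad_eigenspace SO (torus_elt c) j \<subseteq> parabolic SO (torus_elt c') i"
    if "j \<le> i" "0 \<le> i" for i j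
  proof
    fix Y assume Y: "Y \<in> ad_eigenspace SO (torus_elt c) j"
    then have skew: "Y \<in> skew"
      by (simp add: ad_eigenspace_def complexification_lie_algebra_SO)
    have "cscale (matrix_coeff a b Y) (root_vector a b) \<in> parabolic SO (torus_elt c') i"
      if ab: "a \<in> {1..2 * n}" "b \<in> {1..2 * n}" for a b
    proof (cases "a = b \<or> matrix_coeff a b Y = 0")
      case True
      then have "cscale (matrix_coeff a b Y) (root_vector a b) = 0"
        by (auto simp: root_vector_def cscale_def vec_eq_iff)
      then show ?thesis by (simp add: parabolic_def span_zero)
    next
      case False
      then have "weight c a + weight c b = of_int j"
        using matrix_coeff_ad_eigenspace[OF ab Y] by blast
      with weight_sum_le[OF d c'(1) ab] False that \<open>j \<le> i\<close> \<open>0 \<le> i\<close>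
      have "weight c' a + weight c' b \<le> of_int i" by simp
      moreover have "weight c' a + weight c' b \<in> \<int>"
        using c'(2) ab by (intro Ints_add weight_in_Ints)
      then obtain m where m: "weight c' a + weight c' b = of_int m" by (elim Ints_cases)
      ultimately have "m \<le> i" by simp
      then show ?thesis
        using root_vector_ad_eigenspace[OF ab m] unfolding parabolic_def
        by (intro span_base) blast
    qed
    then have "(\<Sum>a\<in>{1..2 * n}. \<Sum>b\<in>{1..2 * n}. cscale (matrix_coeff a b Y) (root_vector a b))
        \<in> parabolic SO (torus_elt c') i"
      unfolding parabolic_def by (intro span_sum)
    then show "Y \<in> parabolic SO (torus_elt c') i"
      unfolding parabolic_def by (subst skew_expansion[OF skew]) (rule span_scale)
  qed
  show "canon_le SO (torus_elt c) (torus_elt c')"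
    unfolding canon_le_def
  proof (intro allI impI)
    fix i :: int assume "0 \<le> i"
    then have "(\<Union>j\<in>{..i}. ad_eigenspace SO (torus_elt c) j) \<subseteq> parabolic SO (torus_elt c') i"
      using sub by blast
    then show "parabolic SO (torus_elt c) i \<subseteq> parabolic SO (torus_elt c') i"
      unfolding parabolic_def by (metis span_minimal subspace_span)
  qed
qed

section \<open>Lattices and roots in torus coordinates\<close>

lemma torus_elt_integer_lattice: "torus_elt c \<in> integer_lattice (D_torus n e) \<longleftrightarrow> integer_coords c"
proof -
  have "(\<exists>z::int. 2 * pi * c i = 2 * pi * z) \<longleftrightarrow> c i \<in> \<int>" for i
    by (auto simp: Ints_def)
  then show ?thesis
    by (simp add: integer_lattice_def D_torus_eq mat_exp_torus_elt_eq_1_iff integer_coords_def)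
qed

lemma torus_elt_half_lattice: "torus_elt c \<in> half_lattice (D_torus n e) \<longleftrightarrow> (\<forall>i\<in>{1..n}. \<exists>z::int. c i = 2 * z)"
proof -
  have "(\<exists>z::int. pi * c i = 2 * pi * z) \<longleftrightarrow> (\<exists>z::int. c i = 2 * z)" for i
    by auto
  then show ?thesis
    by (simp add: half_lattice_def D_torus_eq mat_exp_torus_elt_eq_1_iff)
qed

lemma D_E_eq_torus_elt: "i \<in> {1..n} \<Longrightarrow> D_E n e i = torus_elt (\<lambda>j. if j = i then 1 else 0)"
  unfolding torus_elt_def by (subst sum.mono_neutral_right[of _ "{i}"]) auto

lemma inj_on_D_E: "inj_on (D_E n e) {1..n}"
proof (rule inj_onI)
  fix i j assume ij: "i \<in> {1..n}" "j \<in> {1..n}" "D_E n e i = D_E n e j"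
  then have "torus_elt (\<lambda>k. if k = i then 1 else 0) = torus_elt (\<lambda>k. if k = j then 1 else 0)"
    by (simp add: D_E_eq_torus_elt)
  from torus_elt_eqD[OF this ij(1)] show "i = j" by (simp split: if_splits)
qed

lemma independent_D_E: "independent (D_E n e ` {1..n})"
proof -
  have "\<forall>X\<in>D_E n e ` {1..n}. u X = 0" if "(\<Sum>X\<in>D_E n e ` {1..n}. u X *\<^sub>R X) = 0" for u
  proof -
    have "torus_elt (u \<circ> D_E n e) = torus_elt (\<lambda>_. 0)"
      using that unfolding sum.reindex[OF inj_on_D_E] torus_elt_def by simp
    from torus_elt_eqD[OF this] show ?thesis by auto
  qed
  then show ?thesis
    by (auto simp: dependent_finite)
qed

lemma D_L_torus_elt:
  assumes "i \<in> {1..n}"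
  shows "D_L n e i (torus_elt c) = \<i> * c i"
proof -
  define f where "f X = (if X = D_E n e i then \<i> else 0)" for X
  interpret L: linear "D_L n e i"
    unfolding D_L_def using independent_D_E by (rule linear_construct)
  have "D_L n e i (torus_elt c) = (\<Sum>j=1..n. c j *\<^sub>R D_L n e i (D_E n e j))"
    by (simp add: torus_elt_def L.sum L.scale)
  also have "\<dots> = (\<Sum>j=1..n. if j = i then \<i> * c i else 0)"
  proof (rule sum.cong)
    fix j assume j: "j \<in> {1..n}"
    have "D_L n e i (D_E n e j) = f (D_E n e j)"
      unfolding D_L_def f_def using j by (subst construct_basis[OF independent_D_E]) auto
    then show "c j *\<^sub>R D_L n e i (D_E n e j) = (if j = i then \<i> * c i else 0)"
      using inj_onD[OF inj_on_D_E _ j assms] by (auto simp: f_def scaleR_conv_of_real mult.commute)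
  qed simp
  finally show ?thesis using assms by simp
qed

lemma torus_elt_canonical_lattice:
  "torus_elt c \<in> canonical_lattice (D_torus n e) (D_pos_roots n e) \<longleftrightarrow> integer_coords c \<and> dominant c"
proof -
  have "(\<forall>\<alpha>\<in>D_pos_roots n e. \<alpha> (torus_elt c) / \<i> \<in> \<real>\<^sub>\<ge>\<^sub>0) \<longleftrightarrow>
      (\<forall>i j. 1 \<le> i \<and> i < j \<and> j \<le> n \<longrightarrow>
        (D_L n e i (torus_elt c) + D_L n e j (torus_elt c)) / \<i> \<in> \<real>\<^sub>\<ge>\<^sub>0 \<and>
        (D_L n e i (torus_elt c) - D_L n e j (torus_elt c)) / \<i> \<in> \<real>\<^sub>\<ge>\<^sub>0)"
    by (auto simp: D_pos_roots_def ball_Un)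
  also have "\<dots> \<longleftrightarrow> dominant c"
    unfolding dominant_def
  proof (intro iff_allI imp_cong refl arg_cong2[of _ _ _ _ "(\<and>)"])
    fix i j assume ij: "1 \<le> i \<and> i < j \<and> j \<le> n"
    have plus: "(\<i> * c i + \<i> * c j) / \<i> = complex_of_real (c i + c j)" by (simp add: field_simps)
    have minus: "(\<i> * c i - \<i> * c j) / \<i> = complex_of_real (c i - c j)" by (simp add: field_simps)
    show "((D_L n e i (torus_elt c) + D_L n e j (torus_elt c)) / \<i> \<in> \<real>\<^sub>\<ge>\<^sub>0) = (c i + c j \<ge> 0)"
      using ij plus by (simp add: D_L_torus_elt del: of_real_add)
    show "((D_L n e i (torus_elt c) - D_L n e j (torus_elt c)) / \<i> \<in> \<real>\<^sub>\<ge>\<^sub>0) = (c i - c j \<ge> 0)"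
      using ij minus by (simp add: D_L_torus_elt del: of_real_diff)
  qed
  finally show ?thesis
    by (simp add: canonical_lattice_def torus_elt_integer_lattice)
qed

section \<open>Marks: coordinates in the dual basis\<close>

lemma one_le_pred_n [simp]: "Suc 0 \<le> n - Suc 0"
  using two_le_n by simp

text \<open>The value of the \<open>i\<close>-th simple root on \<open>torus_elt c\<close>, divided by \<open>\<i>\<close>.\<close>
definition mark :: "(nat \<Rightarrow> real) \<Rightarrow> nat \<Rightarrow> real" where
  "mark c i = (if i < n then c i - c (i + 1) else c (n - 1) + c n)"

text \<open>
  The inverse of \<open>mark\<close>: the last two marks determine \<open>c\<^bsub>n-1\<^esub>\<close> and \<open>c\<^sub>n\<close> as half their sum and
  half their difference, and the other marks telescope.
\<close>
definition coord :: "(nat \<Rightarrow> real) \<Rightarrow> nat \<Rightarrow> real" where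
  "coord \<mu> i = (if i < n then (\<Sum>k=i..<n - 1. \<mu> k) + (\<mu> (n - 1) + \<mu> n) / 2 else (\<mu> n - \<mu> (n - 1)) / 2)"

lemma coord_mark:
  assumes "i \<in> {1..n}"
  shows "coord (mark c) i = c i"
proof (cases "i < n")
  case True
  have "(\<Sum>k=i..<n - 1. mark c k) = - (\<Sum>k=i..<n - 1. c (Suc k) - c k)"
    unfolding sum_negf[symmetric] by (intro sum.cong) (auto simp: mark_def)
  also have "\<dots> = c i - c (n - 1)"
    using True by (subst sum_Suc_diff') auto
  finally show ?thesis
    using True two_le_n by (simp add: coord_def mark_def)
next
  case False
  with assms have "i = n" by simp
  then show ?thesis using two_le_n by (simp add: coord_def mark_def)
qed

lemma mark_coord:
  assumes "i \<in> {1..n}"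
  shows "mark (coord \<mu>) i = \<mu> i"
proof -
  consider "i < n - 1" | "i = n - 1" | "i = n" using assms by force
  then show ?thesis
  proof cases
    case 1
    then have "i < n" "Suc i < n" by linarith+
    with 1 show ?thesis by (simp add: mark_def coord_def sum.atLeast_Suc_lessThan[of i])
  next
    case 2
    then show ?thesis using two_le_n by (simp add: mark_def coord_def field_simps)
  next
    case 3
    then show ?thesis using two_le_n by (simp add: mark_def coord_def field_simps)
  qed
qed

text \<open>
  Nonnegative marks make \<open>c\<close> decreasing with \<open>c\<^bsub>n-1\<^esub> + c\<^sub>n \<ge> 0\<close>, and then all positive
  roots are nonnegative: they are sums of simple ones.
\<close>
lemma dominant_iff_mark: "dominant c \<longleftrightarrow> (\<forall>i\<in>{1..n}. mark c i \<ge> 0)"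
proof
  assume "dominant c"
  then have *: "c i + c j \<ge> 0 \<and> c i - c j \<ge> 0" if "1 \<le> i" "i < j" "j \<le> n" for i j
    using that unfolding dominant_def by blast
  show "\<forall>i\<in>{1..n}. mark c i \<ge> 0"
  proof
    fix i assume "i \<in> {1..n}"
    then show "mark c i \<ge> 0"
      using *[of i "i + 1"] *[of "n - 1" n] two_le_n by (auto simp: mark_def)
  qed
next
  assume pos: "\<forall>i\<in>{1..n}. mark c i \<ge> 0"
  have succ_le: "c (Suc i) \<le> c i" if "1 \<le> i" "i < n" for i
    using pos[rule_format, of i] that by (simp add: mark_def)
  have antimono: "c j \<le> c i" if "i \<le> j" "1 \<le> i" "j \<le> n" for i j
    using that
  proof (induction j rule: dec_induct)
    case (step k)
    then show ?case using succ_le[of k] by simp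
  qed simp
  have last: "c (n - 1) + c n \<ge> 0"
    using pos[rule_format, of n] two_le_n by (simp add: mark_def)
  have last': "c (n - 1) \<ge> 0"
    using last antimono[of "n - 1" n] two_le_n by simp
  show "dominant c"
    unfolding dominant_def
  proof (intro allI impI)
    fix i j assume ij: "1 \<le> i \<and> i < j \<and> j \<le> n"
    have "c i \<ge> c (n - 1)" using ij by (intro antimono) auto
    moreover have "c j \<ge> c (n - 1)" if "j \<noteq> n"
      using ij that by (intro antimono) auto
    ultimately show "c i + c j \<ge> 0 \<and> c i - c j \<ge> 0"
      using last last' antimono[of i j] ij by (cases "j = n") auto
  qed
qed

definition mark_elt :: "(nat \<Rightarrow> real) \<Rightarrow> complex^'m^'m" where
  "mark_elt \<mu> = torus_elt (coord \<mu>)"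

lemma coord_cong: "(\<And>k. k \<in> {1..n} \<Longrightarrow> \<mu> k = \<nu> k) \<Longrightarrow> i \<in> {1..n} \<Longrightarrow> coord \<mu> i = coord \<nu> i"
  using two_le_n by (auto simp: coord_def intro!: sum.cong arg_cong2[of _ _ _ _ "(+)"])

lemma mark_elt_cong: "(\<And>i. i \<in> {1..n} \<Longrightarrow> \<mu> i = \<nu> i) \<Longrightarrow> mark_elt \<mu> = mark_elt \<nu>"
  unfolding mark_elt_def by (intro torus_elt_cong coord_cong)

lemma mark_elt_eqD: "mark_elt \<mu> = mark_elt \<nu> \<Longrightarrow> i \<in> {1..n} \<Longrightarrow> \<mu> i = \<nu> i"
proof -
  assume eq: "mark_elt \<mu> = mark_elt \<nu>" and i: "i \<in> {1..n}"
  have "mark (coord \<mu>) i = mark (coord \<nu>) i"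
    using torus_elt_eqD[OF eq[unfolded mark_elt_def]] i two_le_n by (simp add: mark_def)
  then show ?thesis using i by (simp only: mark_coord)
qed

lemma torus_elt_eq_mark_elt: "torus_elt c = mark_elt (mark c)"
  unfolding mark_elt_def by (rule torus_elt_cong) (simp only: coord_mark)

lemma coord_diff: "coord (\<lambda>i. \<mu> i - \<nu> i) k = coord \<mu> k - coord \<nu> k"
  by (simp add: coord_def sum_subtractf field_simps)

lemma mark_elt_diff: "mark_elt \<mu> - mark_elt \<nu> = mark_elt (\<lambda>i. \<mu> i - \<nu> i)"
  unfolding mark_elt_def torus_elt_diff coord_diff[abs_def] ..

lemma mark_elt_add: "mark_elt (\<lambda>i. \<mu> i + \<nu> i) = mark_elt \<mu> + mark_elt \<nu>"
proof -
  have "mark_elt (\<lambda>i. \<mu> i + \<nu> i) - mark_elt \<nu> = mark_elt \<mu>" by (simp add: mark_elt_diff)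
  then show ?thesis by (simp add: algebra_simps)
qed

lemma mark_elt_scaleR: "mark_elt (\<lambda>i. r * \<mu> i) = r *\<^sub>R mark_elt \<mu>"
proof -
  have "coord (\<lambda>i. r * \<mu> i) k = r * coord \<mu> k" for k
    by (simp add: coord_def field_simps sum_distrib_left)
  then show ?thesis by (simp add: mark_elt_def torus_elt_def scaleR_right.sum)
qed

lemma mark_elt_0: "mark_elt (\<lambda>_. 0) = 0"
  using mark_elt_scaleR[of 0 "\<lambda>_. 0"] by simp

lemma mark_elt_sum: "mark_elt (\<lambda>i. \<Sum>j\<in>J. f j i) = (\<Sum>j\<in>J. mark_elt (f j))"
  by (induction J rule: infinite_finite_induct) (simp_all add: mark_elt_add mark_elt_0)

lemma D_simple_root_torus_elt:
  "i \<in> {1..n} \<Longrightarrow> D_simple_root n e i (torus_elt c) = \<i> * mark c i"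
  using two_le_n by (auto simp: D_simple_root_def mark_def D_L_torus_elt algebra_simps)

lemma D_H_eq_mark_elt:
  assumes "j \<in> {1..n}"
  shows "D_H n e j = mark_elt (\<lambda>i. if i = j then 1 else 0)"
  unfolding D_H_def dual_basis_def
proof (rule the_equality)
  show "mark_elt (\<lambda>i. if i = j then 1 else 0) \<in> D_torus n e \<and>
      (\<forall>i\<in>{1..n}. D_simple_root n e i (mark_elt (\<lambda>i. if i = j then 1 else 0)) = (if i = j then \<i> else 0))"
    unfolding mark_elt_def D_torus_eq by (auto simp: D_simple_root_torus_elt mark_coord)
next
  fix X assume X: "X \<in> D_torus n e \<and> (\<forall>i\<in>{1..n}. D_simple_root n e i X = (if i = j then \<i> else 0))"
  then obtain c where c: "X = torus_elt c" by (auto simp: D_torus_eq)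
  have "mark c i = (if i = j then 1 else 0)" if "i \<in> {1..n}" for i
  proof -
    have "\<i> * mark c i = (if i = j then \<i> else 0)"
      using X that D_simple_root_torus_elt[OF that, of c] unfolding c by metis
    then show ?thesis by (auto split: if_splits)
  qed
  then show "X = mark_elt (\<lambda>i. if i = j then 1 else 0)"
    unfolding c torus_elt_eq_mark_elt by (rule mark_elt_cong)
qed

section \<open>The canonical lattice and its order in terms of marks\<close>

text \<open>
  The parity condition expresses that \<open>c\<^bsub>n-1\<^esub>\<close>, half the sum of the last two marks, is an integer.
\<close>
lemma canonical_lattice_eq:
  "canonical_lattice (D_torus n e) (D_pos_roots n e) =
    {mark_elt (\<lambda>i. real (m i)) | m. even (m (n - 1) + m n)}"
proof (intro equalityI subsetI)
  fix \<xi> assume \<xi>: "\<xi> \<in> canonical_lattice (D_torus n e) (D_pos_roots n e)"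
  then have "\<xi> \<in> D_torus n e" by (simp add: canonical_lattice_def integer_lattice_def)
  then obtain c where c: "\<xi> = torus_elt c" by (auto simp: D_torus_eq)
  have "integer_coords c" and dom: "dominant c" using \<xi> by (simp_all add: c torus_elt_canonical_lattice)
  then have int: "c i \<in> \<int>" if "i \<in> {1..n}" for i using that by (simp add: integer_coords_def)
  define m where "m i = nat \<lfloor>mark c i\<rfloor>" for i
  have m: "mark c i = real (m i)" if "i \<in> {1..n}" for i
  proof -
    have "mark c i \<in> \<int>"
      using that two_le_n by (auto simp: mark_def intro!: Ints_diff Ints_add int)
    moreover have "mark c i \<ge> 0" using dom that by (simp add: dominant_iff_mark)
    ultimately show ?thesis by (simp add: m_def)
  qed
  have "n - 1 \<in> {1..n}" using two_le_n by auto
  from int[OF this] obtain z :: int where z: "c (n - 1) = z" by (rule Ints_cases)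
  have "real (m (n - 1) + m n) = 2 * c (n - 1)"
    using m[of "n - 1"] m[of n] two_le_n by (simp add: mark_def)
  then have "real_of_int (int (m (n - 1) + m n)) = real_of_int (2 * z)" unfolding z by simp
  then have "int (m (n - 1) + m n) = 2 * z" by (simp only: of_int_eq_iff)
  then have "even (m (n - 1) + m n)" by presburger
  moreover have "\<xi> = mark_elt (\<lambda>i. real (m i))"
    unfolding c torus_elt_eq_mark_elt by (rule mark_elt_cong) (rule m)
  ultimately show "\<xi> \<in> {mark_elt (\<lambda>i. real (m i)) | m. even (m (n - 1) + m n)}" by blast
next
  fix \<xi> assume "\<xi> \<in> {mark_elt (\<lambda>i. real (m i)) | m. even (m (n - 1) + m n)}"
  then obtain m where m: "\<xi> = mark_elt (\<lambda>i. real (m i))" and ev: "even (m (n - 1) + m n)" by blast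
  from ev obtain k where k: "m (n - 1) + m n = 2 * k" by blast
  have "(real (m (n - 1)) + real (m n)) / 2 = of_int (int k)"
    using arg_cong[OF k, of real] by simp
  then have half1: "(real (m (n - 1)) + real (m n)) / 2 \<in> \<int>" by (metis Ints_of_int)
  have "(real (m n) - real (m (n - 1))) / 2 = of_int (int k - int (m (n - 1)))"
    using arg_cong[OF k, of real] by simp
  then have half2: "(real (m n) - real (m (n - 1))) / 2 \<in> \<int>" by (metis Ints_of_int)
  have "integer_coords (coord (\<lambda>i. real (m i)))"
    using half1 half2 by (auto simp: integer_coords_def coord_def intro!: Ints_add Ints_sum)
  moreover have "dominant (coord (\<lambda>i. real (m i)))"
    unfolding dominant_iff_mark by (auto simp: mark_coord)
  ultimately show "\<xi> \<in> canonical_lattice (D_torus n e) (D_pos_roots n e)"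
    by (simp add: m mark_elt_def torus_elt_canonical_lattice)
qed

text \<open>
  Evenness of \<open>c\<^bsub>n-1\<^esub>\<close> and \<open>c\<^sub>n\<close> says that the sum and the difference of the last two marks
  are divisible by 4; given this, evenness of the remaining coordinates passes to their successive
  differences, the remaining marks, and back.
\<close>
lemma mark_elt_half_lattice:
  fixes d :: "nat \<Rightarrow> int"
  shows "mark_elt (\<lambda>i. of_int (d i)) \<in> half_lattice (D_torus n e) \<longleftrightarrow>
    (\<forall>i\<in>{1..n}. even (d i)) \<and> 4 dvd d (n - 1) + d n"
proof -
  let ?c = "coord (\<lambda>i. of_int (d i))"
  have last: "(\<exists>z::int. ?c n = 2 * z) \<longleftrightarrow> 4 dvd d n - d (n - 1)"
  proof -
    have "?c n = 2 * real_of_int z \<longleftrightarrow> d n - d (n - 1) = 4 * z" for z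
      unfolding of_int_eq_iff[where 'a=real, symmetric] by (simp add: coord_def field_simps)
    then show ?thesis by (simp add: dvd_def)
  qed
  have sublast: "(\<exists>z::int. ?c (n - 1) = 2 * z) \<longleftrightarrow> 4 dvd d (n - 1) + d n"
  proof -
    have "?c (n - 1) = 2 * real_of_int z \<longleftrightarrow> d (n - 1) + d n = 4 * z" for z
      unfolding of_int_eq_iff[where 'a=real, symmetric]
      using two_le_n by (simp add: coord_def field_simps)
    then show ?thesis by (simp add: dvd_def)
  qed
  have "(\<forall>i\<in>{1..n}. \<exists>z::int. ?c i = 2 * z) \<longleftrightarrow>
      (\<forall>i\<in>{1..n}. even (d i)) \<and> 4 dvd d (n - 1) + d n"
  proof (intro iffI conjI)
    assume *: "\<forall>i\<in>{1..n}. \<exists>z::int. ?c i = 2 * z"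
    show 4: "4 dvd d (n - 1) + d n" using * two_le_n sublast by auto
    moreover have "4 dvd d n - d (n - 1)" using * two_le_n last by auto
    ultimately have ev: "even (d (n - 1))" "even (d n)"
      using four_dvd_pair_iff by blast+
    show "\<forall>i\<in>{1..n}. even (d i)"
    proof
      fix i assume i: "i \<in> {1..n}"
      show "even (d i)"
      proof (cases "i < n")
        case True
        with * i obtain z z' :: int where "?c i = 2 * z" "?c (i + 1) = 2 * z'" by fastforce
        then have "real_of_int (d i) = real_of_int (2 * (z - z'))"
          using mark_coord[OF i, of "\<lambda>i. of_int (d i)"] True by (simp add: mark_def)
        then show ?thesis by (simp only: of_int_eq_iff) simp
      next
        case False
        then show ?thesis using i ev by simp
      qed
    qed
  next
    assume *: "(\<forall>i\<in>{1..n}. even (d i)) \<and> 4 dvd d (n - 1) + d n"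
    then have ev: "even (d (n - 1))" "even (d n)" using two_le_n by auto
    show "\<forall>i\<in>{1..n}. \<exists>z::int. ?c i = 2 * z"
    proof
      fix i assume i: "i \<in> {1..n}"
      show "\<exists>z::int. ?c i = 2 * z"
      proof (cases "i < n")
        case True
        have "even (\<Sum>k=i..<n - 1. d k)" using * i by (intro dvd_sum) auto
        then obtain y where y: "(\<Sum>k=i..<n - 1. d k) = 2 * y" by blast
        obtain x where x: "d (n - 1) + d n = 4 * x" using * by blast
        have "?c i = 2 * real_of_int (y + x)"
          using arg_cong[OF y, of real_of_int] arg_cong[OF x, of real_of_int] True
          by (simp add: coord_def field_simps)
        then show ?thesis by blast
      next
        case False
        then show ?thesis
          using i last * ev four_dvd_pair_iff[of "d n" "d (n - 1)"] by simp
      qed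
    qed
  qed
  then show ?thesis by (simp add: mark_elt_def torus_elt_half_lattice)
qed

lemma sym_canon_le_mark_elt_iff:
  assumes "even (m (n - 1) + m n)" "even (m' (n - 1) + m' n)"
  shows "sym_canon_le SO (D_torus n e) (mark_elt (\<lambda>i. real (m i))) (mark_elt (\<lambda>i. real (m' i))) \<longleftrightarrow>
    (\<forall>i\<in>{1..n}. m' i \<le> m i \<and> even (m i - m' i)) \<and> 4 dvd (m (n - 1) - m' (n - 1)) + (m n - m' n)"
proof -
  have canon: "integer_coords (coord (\<lambda>i. real (m i)))" "dominant (coord (\<lambda>i. real (m i)))"
    if "even (m (n - 1) + m n)" for m
    using that canonical_lattice_eq torus_elt_canonical_lattice unfolding mark_elt_def by blast+
  have le: "canon_le SO (mark_elt (\<lambda>i. real (m i))) (mark_elt (\<lambda>i. real (m' i)))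
      \<longleftrightarrow> (\<forall>i\<in>{1..n}. m' i \<le> m i)"
    unfolding mark_elt_def
    by (subst canon_le_torus_elt_iff[OF canon(2,1) canon(2,1)])
      (simp_all only: assms flip: coord_diff, simp_all only: dominant_iff_mark, auto simp: mark_coord)
  have half: "mark_elt (\<lambda>i. real (m i)) - mark_elt (\<lambda>i. real (m' i)) \<in> half_lattice (D_torus n e)
      \<longleftrightarrow> (\<forall>i\<in>{1..n}. even (m i - m' i)) \<and> 4 dvd (m (n - 1) - m' (n - 1)) + (m n - m' n)"
    if "\<forall>i\<in>{1..n}. m' i \<le> m i"
  proof -
    have "mark_elt (\<lambda>i. real (m i)) - mark_elt (\<lambda>i. real (m' i))
        = mark_elt (\<lambda>i. of_int (int (m i - m' i)))"
      unfolding mark_elt_diff using that by (intro mark_elt_cong) (simp add: of_nat_diff)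
    moreover have "4 dvd int (m (n - 1) - m' (n - 1)) + int (m n - m' n) \<longleftrightarrow>
        4 dvd (m (n - 1) - m' (n - 1)) + (m n - m' n)"
      by presburger
    ultimately show ?thesis by (simp only: mark_elt_half_lattice even_of_nat_iff)
  qed
  show ?thesis using le half unfolding sym_canon_le_def by blast
qed

section \<open>Maximal elements\<close>

text \<open>
  The marks from which nothing admissible can be subtracted: neither 2 before the last two places,
  nor 4 in one of the last two, nor 2 in both.
\<close>
definition reduced :: "(nat \<Rightarrow> nat) \<Rightarrow> bool" where
  "reduced m \<longleftrightarrow> even (m (n - 1) + m n) \<and> (\<forall>i\<in>{1..<n - 1}. m i \<le> 1) \<and>
     m (n - 1) < 4 \<and> m n < 4 \<and> \<not> (2 \<le> m (n - 1) \<and> 2 \<le> m n)"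

lemma reduced_minimal:
  assumes "reduced m" "even (m' (n - 1) + m' n)"
    and le: "\<forall>i\<in>{1..n}. m' i \<le> m i \<and> even (m i - m' i)"
    and four: "4 dvd (m (n - 1) - m' (n - 1)) + (m n - m' n)"
    and i: "i \<in> {1..n}"
  shows "m' i = m i"
proof -
  have "n - 1 \<in> {1..n}" "n \<in> {1..n}" using two_le_n by auto
  then have "m' (n - 1) \<le> m (n - 1)" "even (m (n - 1) - m' (n - 1))" "m' n \<le> m n" "even (m n - m' n)"
    using le by blast+
  with assms(1) four have last: "m' (n - 1) = m (n - 1) \<and> m' n = m n"
    unfolding reduced_def by (intro minimal_pair) blast+
  consider "i \<in> {1..<n - 1}" | "i = n - 1" | "i = n" using i by force
  then show ?thesis
  proof cases
    case 1
    then have "m i \<le> 1" using assms(1) unfolding reduced_def by blast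
    moreover have "m' i \<le> m i" "even (m i - m' i)" using le i by blast+
    ultimately show ?thesis by presburger
  qed (use last in simp_all)
qed

text \<open>
  Each way of violating \<open>reduced\<close> leaves room to subtract the corresponding amount.
\<close>
lemma not_reduced_imp_lower:
  assumes ev: "even (m (n - 1) + m n)" and "\<not> reduced m"
  obtains m' i where "even (m' (n - 1) + m' n)"
    "\<forall>i\<in>{1..n}. m' i \<le> m i \<and> even (m i - m' i)"
    "4 dvd (m (n - 1) - m' (n - 1)) + (m n - m' n)"
    "i \<in> {1..n}" "m' i \<noteq> m i"
proof -
  have n: "n - 1 \<noteq> n" "n - 1 \<in> {1..n}" "n \<in> {1..n}" using two_le_n by auto
  have "\<exists>i\<in>{1..<n - 1}. 2 \<le> m i" if "m (n - 1) < 4" "m n < 4" "\<not> (2 \<le> m (n - 1) \<and> 2 \<le> m n)"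
    using assms that unfolding reduced_def by force
  then consider i where "i \<in> {1..<n - 1}" "2 \<le> m i" | "4 \<le> m (n - 1)" | "4 \<le> m n"
    | "2 \<le> m (n - 1)" "2 \<le> m n"
    by (meson not_le)
  then show thesis
  proof cases
    case 1
    then have "i \<noteq> n - 1" "i \<noteq> n" "i \<in> {1..n}" by auto
    with 1 ev show thesis
      by (intro that[of "m(i := m i - 2)" i]) auto
  next
    case 2
    with n ev show thesis
      by (intro that[of "m(n - 1 := m (n - 1) - 4)" "n - 1"]) auto
  next
    case 3
    with n ev show thesis
      by (intro that[of "m(n := m n - 4)" n]) auto
  next
    case 4
    with n ev show thesis
      by (intro that[of "m(n - 1 := m (n - 1) - 2, n := m n - 2)" n]) auto
  qed
qed

lemma symmetric_canonical_elements_eq: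
  "symmetric_canonical_elements SO (D_torus n e) (D_pos_roots n e) =
    {mark_elt (\<lambda>i. real (m i)) | m. reduced m}"
proof (intro equalityI subsetI)
  fix \<xi> assume \<xi>: "\<xi> \<in> symmetric_canonical_elements SO (D_torus n e) (D_pos_roots n e)"
  then obtain m where m: "\<xi> = mark_elt (\<lambda>i. real (m i))" "even (m (n - 1) + m n)"
    unfolding symmetric_canonical_elements_def canonical_lattice_eq by blast
  have "reduced m"
  proof (rule ccontr)
    assume "\<not> reduced m"
    with m(2) obtain m' i where m': "even (m' (n - 1) + m' n)"
      "\<forall>i\<in>{1..n}. m' i \<le> m i \<and> even (m i - m' i)"
      "4 dvd (m (n - 1) - m' (n - 1)) + (m n - m' n)"
      "i \<in> {1..n}" "m' i \<noteq> m i"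
      by (rule not_reduced_imp_lower)
    have "sym_canon_le SO (D_torus n e) \<xi> (mark_elt (\<lambda>i. real (m' i)))"
      unfolding m(1) sym_canon_le_mark_elt_iff[OF m(2) m'(1)] using m'(2,3) by blast
    moreover have "mark_elt (\<lambda>i. real (m' i)) \<in> canonical_lattice (D_torus n e) (D_pos_roots n e)"
      unfolding canonical_lattice_eq using m'(1) by blast
    ultimately have "mark_elt (\<lambda>i. real (m' i)) = mark_elt (\<lambda>i. real (m i))"
      using \<xi> unfolding symmetric_canonical_elements_def m(1) by blast
    from mark_elt_eqD[OF this m'(4)] m'(5) show False by simp
  qed
  with m(1) show "\<xi> \<in> {mark_elt (\<lambda>i. real (m i)) | m. reduced m}" by blast
next
  fix \<xi> assume "\<xi> \<in> {mark_elt (\<lambda>i. real (m i)) | m. reduced m}"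
  then obtain m where m: "\<xi> = mark_elt (\<lambda>i. real (m i))" "reduced m" by blast
  then have ev: "even (m (n - 1) + m n)" by (simp add: reduced_def)
  have "\<xi>' = \<xi>" if lat: "\<xi>' \<in> canonical_lattice (D_torus n e) (D_pos_roots n e)"
    and le: "sym_canon_le SO (D_torus n e) \<xi> \<xi>'" for \<xi>'
  proof -
    obtain m' where m': "\<xi>' = mark_elt (\<lambda>i. real (m' i))" "even (m' (n - 1) + m' n)"
      using lat unfolding canonical_lattice_eq by blast
    have "m' i = m i" if "i \<in> {1..n}" for i
      using le reduced_minimal[OF m(2) m'(2) _ _ that]
      unfolding m(1) m'(1) sym_canon_le_mark_elt_iff[OF ev m'(2)] by blast
    then show ?thesis unfolding m(1) m'(1) by (intro mark_elt_cong) simp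
  qed
  moreover have "\<xi> \<in> canonical_lattice (D_torus n e) (D_pos_roots n e)"
    unfolding canonical_lattice_eq m(1) using ev by blast
  ultimately show "\<xi> \<in> symmetric_canonical_elements SO (D_torus n e) (D_pos_roots n e)"
    unfolding symmetric_canonical_elements_def by blast
qed

lemma D_xi_add_eq_mark_elt:
  assumes I: "I \<subseteq> {1..n}" and r: "r = 0 \<or> s \<in> {1..n}"
  shows "D_xi n e I + r *\<^sub>R D_H n e s = mark_elt (\<lambda>i. of_bool (i \<in> I) + (if i = s then r else 0))"
proof -
  have fin: "finite I" using I finite_subset by blast
  have "D_xi n e I = (\<Sum>j\<in>I. mark_elt (\<lambda>i. if i = j then 1 else 0))"
    unfolding D_xi_def using I by (intro sum.cong refl D_H_eq_mark_elt) auto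
  also have "\<dots> = mark_elt (\<lambda>i. \<Sum>j\<in>I. if i = j then 1 else 0)"
    by (rule mark_elt_sum[symmetric])
  also have "(\<lambda>i. \<Sum>j\<in>I. if i = j then 1 else 0) = (\<lambda>i. of_bool (i \<in> I) :: real)"
    using fin by (simp add: fun_eq_iff)
  finally have xi: "D_xi n e I = mark_elt (\<lambda>i. of_bool (i \<in> I))" .
  have "r *\<^sub>R D_H n e s = mark_elt (\<lambda>i. if i = s then r else 0)"
  proof (cases "r = 0")
    case True
    then have "(\<lambda>i. if i = s then r else 0) = (\<lambda>_. 0)" by auto
    with True show ?thesis by (simp only: mark_elt_0 scaleR_zero_left)
  next
    case False
    with r have "r *\<^sub>R D_H n e s = mark_elt (\<lambda>i. r * (if i = s then 1 else 0))"
      by (simp add: D_H_eq_mark_elt mark_elt_scaleR)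
    also have "(\<lambda>i. r * (if i = s then 1 else 0)) = (\<lambda>i. if i = s then r else 0)" by auto
    finally show ?thesis .
  qed
  then show ?thesis by (simp add: xi mark_elt_add)
qed

lemma eps_eq: "eps n k I = (if of_bool (n - 1 \<in> I) + of_bool (n \<in> I) = k then 1 else 0)"
proof -
  have "n - 1 \<noteq> n" using two_le_n by simp
  then have "card (I \<inter> {n - 1, n}) = of_bool (n - 1 \<in> I) + of_bool (n \<in> I)"
    by (simp add: Int_insert_right)
  then show ?thesis by (simp add: eps_def)
qed

lemma symmetric_canonical_elements_normal_form:
  "symmetric_canonical_elements SO (D_torus n e) (D_pos_roots n e) =
    {\<xi>. \<exists>I s. I \<subseteq> {1..n} \<and> ({n - 1, n} \<inter> I \<noteq> {} \<longrightarrow> s \<in> {n - 1, n} \<inter> I) \<and>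
       (\<xi> = D_xi n e I + eps n 1 I *\<^sub>R D_H n e s \<or>
        \<xi> = D_xi n e I + eps n 1 I *\<^sub>R D_H n e s + (2 * eps n 2 I) *\<^sub>R D_H n e s)}"
  (is "?L = ?R")
proof (intro equalityI subsetI)
  have n: "n - 1 \<noteq> n" "n - 1 \<in> {1..n}" "n \<in> {1..n}" using two_le_n by auto
  fix \<xi>
  {
    assume "\<xi> \<in> ?L"
    then obtain m where m: "\<xi> = mark_elt (\<lambda>i. real (m i))" "reduced m"
      unfolding symmetric_canonical_elements_eq by blast
    define I where "I = {i \<in> {1..n}. 0 < m i}"
    \<comment> \<open>The larger of the last two marks carries the extra multiple of \<open>H\<^sub>s\<close>; \<open>q\<close> tells
      \<open>(3,1)\<close> and \<open>(1,3)\<close> from the other pairs.\<close>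
    define s where "s = (if m n \<le> m (n - 1) then n - 1 else n)"
    define q where "q = (if m (n - 1) + m n = 4 then 1 else 0 :: real)"
    have I: "I \<subseteq> {1..n}" by (auto simp: I_def)
    have s: "{n - 1, n} \<inter> I \<noteq> {} \<longrightarrow> s \<in> {n - 1, n} \<inter> I"
      using n by (auto simp: I_def s_def)
    have s': "s \<in> {1..n}" using n by (simp add: s_def)
    have mem: "n - 1 \<in> I \<longleftrightarrow> 0 < m (n - 1)" "n \<in> I \<longleftrightarrow> 0 < m n"
      using n by (simp_all add: I_def)
    from m(2) have pair: "m (n - 1) = 0 \<and> m n = 0 \<or> m (n - 1) = 2 \<and> m n = 0 \<or>
        m (n - 1) = 0 \<and> m n = 2 \<or> m (n - 1) = 1 \<and> m n = 1 \<or>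
        m (n - 1) = 3 \<and> m n = 1 \<or> m (n - 1) = 1 \<and> m n = 3"
      unfolding reduced_def by (intro minimal_pair_cases) blast+
    have last: "real (m i) = of_bool (i \<in> I) + (if i = s then eps n 1 I + q * (2 * eps n 2 I) else 0)"
      if "i = n - 1 \<or> i = n" for i
      using pair that n(1)
      by (elim disjE conjE) (simp_all add: eps_eq mem mem[simplified] s_def q_def)
    have "\<xi> = mark_elt (\<lambda>i. of_bool (i \<in> I) + (if i = s then eps n 1 I + q * (2 * eps n 2 I) else 0))"
      unfolding m(1)
    proof (rule mark_elt_cong)
      fix i assume i: "i \<in> {1..n}"
      show "real (m i) = of_bool (i \<in> I) + (if i = s then eps n 1 I + q * (2 * eps n 2 I) else 0)"
      proof (cases "i = n - 1 \<or> i = n")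
        case False
        then have "i \<in> {1..<n - 1}" using i by auto
        then have "m i \<le> 1" using m(2) unfolding reduced_def by blast
        with False i show ?thesis by (auto simp: s_def I_def)
      qed (rule last)
    qed
    also have "\<dots> = D_xi n e I + (eps n 1 I + q * (2 * eps n 2 I)) *\<^sub>R D_H n e s"
      using D_xi_add_eq_mark_elt[OF I disjI2[OF s']] by (rule sym)
    finally have \<xi>: "\<xi> = D_xi n e I + (eps n 1 I + q * (2 * eps n 2 I)) *\<^sub>R D_H n e s" .
    have "\<xi> = D_xi n e I + eps n 1 I *\<^sub>R D_H n e s \<or>
        \<xi> = D_xi n e I + eps n 1 I *\<^sub>R D_H n e s + (2 * eps n 2 I) *\<^sub>R D_H n e s"
    proof (cases "m (n - 1) + m n = 4")
      case True
      then have "q = 1" by (simp add: q_def)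
      then show ?thesis unfolding \<xi> by (simp add: scaleR_add_left)
    next
      case False
      then have "q = 0" by (simp add: q_def)
      then show ?thesis unfolding \<xi> by simp
    qed
    with I s show "\<xi> \<in> ?R" by blast
  next
    assume "\<xi> \<in> ?R"
    then obtain I s where I: "I \<subseteq> {1..n}" and s: "{n - 1, n} \<inter> I \<noteq> {} \<longrightarrow> s \<in> {n - 1, n} \<inter> I"
      and \<xi>: "\<xi> = D_xi n e I + eps n 1 I *\<^sub>R D_H n e s \<or>
        \<xi> = D_xi n e I + eps n 1 I *\<^sub>R D_H n e s + (2 * eps n 2 I) *\<^sub>R D_H n e s"
      by blast
    \<comment> \<open>The two forms are treated at once: \<open>q = 0\<close> is the first and \<open>q = 1\<close> the second.\<close>
    from \<xi> obtain q :: nat where q: "q \<le> 1"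
      and \<xi>': "\<xi> = D_xi n e I + (eps n 1 I + q * (2 * eps n 2 I)) *\<^sub>R D_H n e s"
    proof
      assume "\<xi> = D_xi n e I + eps n 1 I *\<^sub>R D_H n e s"
      then show thesis by (intro that[of 0]) simp_all
    next
      assume "\<xi> = D_xi n e I + eps n 1 I *\<^sub>R D_H n e s + (2 * eps n 2 I) *\<^sub>R D_H n e s"
      then show thesis by (intro that[of 1]) (simp_all add: scaleR_add_left)
    qed
    define r :: nat where "r =
      (if (n - 1 \<in> I) \<noteq> (n \<in> I) then 1 else if n - 1 \<in> I then 2 * q else 0)"
    have r: "eps n 1 I + q * (2 * eps n 2 I) = real r"
      unfolding eps_eq r_def by (cases "n - 1 \<in> I"; cases "n \<in> I") simp_all
    define m where "m i = of_bool (i \<in> I) + (if i = s then r else 0)" for i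
    have pattern: "n - 1 \<notin> I \<and> n \<notin> I \<and> r = 0 \<or> n - 1 \<in> I \<and> n \<notin> I \<and> s = n - 1 \<and> r = 1 \<or>
        n - 1 \<notin> I \<and> n \<in> I \<and> s = n \<and> r = 1 \<or>
        n - 1 \<in> I \<and> n \<in> I \<and> (s = n - 1 \<or> s = n) \<and> r = 2 * q"
    proof (cases "n - 1 \<in> I"; cases "n \<in> I")
      assume *: "n - 1 \<in> I" "n \<in> I"
      then have "r = 2 * q" by (simp only: r_def simp_thms if_True if_False)
      moreover have "s = n - 1 \<or> s = n" using s * by blast
      ultimately show ?thesis using * by blast
    next
      assume *: "n - 1 \<in> I" "n \<notin> I"
      then have "r = 1" by (simp only: r_def simp_thms if_True if_False)
      moreover have "s = n - 1" using s * by blast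
      ultimately show ?thesis using * by blast
    next
      assume *: "n - 1 \<notin> I" "n \<in> I"
      then have "r = 1" by (simp only: r_def simp_thms if_True if_False)
      moreover have "s = n" using s * by blast
      ultimately show ?thesis using * by blast
    next
      assume *: "n - 1 \<notin> I" "n \<notin> I"
      then have "r = 0" by (simp only: r_def simp_thms if_True if_False)
      then show ?thesis using * by blast
    qed
    have "r = 0 \<or> s \<in> {1..n}"
      using pattern n(2,3) by blast
    then have "\<xi> = mark_elt (\<lambda>i. of_bool (i \<in> I) + (if i = s then real r else 0))"
      unfolding \<xi>' r by (intro D_xi_add_eq_mark_elt[OF I]) simp
    also have "\<dots> = mark_elt (\<lambda>i. real (m i))"
      by (rule mark_elt_cong) (simp add: m_def)
    finally have "\<xi> = mark_elt (\<lambda>i. real (m i))" .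
    moreover have "reduced m"
    proof -
      have "m i \<le> 1" if "i \<in> {1..<n - 1}" for i
      proof -
        have "i \<noteq> n - 1" "i \<noteq> n" using that by auto
        then have "r = 0 \<or> i \<noteq> s" using pattern by blast
        then show ?thesis by (auto simp: m_def)
      qed
      moreover have "even (m (n - 1) + m n) \<and> m (n - 1) < 4 \<and> m n < 4 \<and> \<not> (2 \<le> m (n - 1) \<and> 2 \<le> m n)"
      proof -
        have "q = 0 \<or> q = 1" using q by linarith
        moreover have "m (n - 1) = of_bool (n - 1 \<in> I) + (if s = n - 1 then r else 0)"
          "m n = of_bool (n \<in> I) + (if s = n then r else 0)"
          by (auto simp: m_def)
        ultimately show ?thesis
          using pattern n(1) by (elim disjE conjE) simp_all
      qed
      ultimately show ?thesis unfolding reduced_def by blast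
    qed
    ultimately show "\<xi> \<in> ?L" unfolding symmetric_canonical_elements_eq by blast
  }
qed

end

theorem theorem6p13:
  fixes n :: nat and e :: "nat \<Rightarrow> complex^'m"
  assumes "3 \<le> n" and "CARD('m) = 2 * n" and "isotropic_basis n e"
  shows "symmetric_canonical_elements SO (D_torus n e) (D_pos_roots n e) =
    {\<xi>. \<exists>I s. I \<subseteq> {1..n} \<and> ({n - 1, n} \<inter> I \<noteq> {} \<longrightarrow> s \<in> {n - 1, n} \<inter> I) \<and>
       (\<xi> = D_xi n e I + eps n 1 I *\<^sub>R D_H n e s \<or>
        \<xi> = D_xi n e I + eps n 1 I *\<^sub>R D_H n e s + (2 * eps n 2 I) *\<^sub>R D_H n e s)}"
proof -
  interpret isotropic_frame n e
    using assms by unfold_locales auto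
  show ?thesis by (rule symmetric_canonical_elements_normal_form)
qed

end
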